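(* Let $G=\bigoplus_{i\in I}G_i$ be a Warfield group with torsion subgroup $T$, where each $G_i\in\mathcal B$. Consider the following condition on a positive integer $n$: $(\ast)$ there is no subset $\{i_1,i_2,\dots,i_n\}$ of $I$ with exactly $n$ (distinct) elements such that $G_{i_1}\precsim G_{i_2}\precsim\cdots\precsim G_{i_{n-1}}\precsim G_{i_n}$. (1) If $G$ is strongly Hopfian, then there is a positive integer $n$ satisfying $(\ast)$. (2) $G$ is uniformly strongly Hopfian if and only if there is a positive integer $n$ satisfying $(\ast)$ and $T$ is strongly Hopfian.
   Context: All groups are abelian and written additively. $\mathbb N$ denotes the positive integers. A group $G$ is strongly Hopfian (SH) if for every endomorphism $\phi$ of $G$ there is $n\in\mathbb N$ such that $\phi$ restricted to $\phi^n(G)$ is injective (equivalently, $\ker\phi^n=\ker\phi^m$ for all $m\ge n$); such an $n$ is called an SH-exponent for $\phi$. $G$ is uniformly SH if a single $n\in\mathbb N$ is an SH-exponent for all endomorphisms of $G$. A (global) Warfield group is a group isomorphic to a direct summand of a simply presented group, i.e. of a group definable by generators and relations all of the form $mx=0$ or $mx=y$ with $x,y$ generators and $m$ an integer. $\mathcal B$ denotes the class of all groups of torsion-free rank 1 with bounded $p$-torsion, meaning that for every prime $p$ the $p$-torsion subgroup is bounded (annihilated by some power of $p$). For $A,A'\in\mathcal B$, write $A\precsim A'$ if there is a homomorphism $\phi:A\to A'$ such that $\phi(A)$ is not contained in the torsion subgroup of $A'$. *)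

theory Defs
  imports "HOL-Algebra.Product_Groups" "HOL-Algebra.Free_Abelian_Groups" "HOL-Computational_Algebra.Primes"
begin

text \<open>Abelian groups are \<open>comm_group\<close> structures of HOL-Algebra, hence written multiplicatively:
  \<open>x [^]\<^bsub>G\<^esub> m\<close> stands for the multiple \<open>m x\<close>, and \<open>\<one>\<^bsub>G\<^esub>\<close> for \<open>0\<close>.\<close>

definition torsion_part :: "('a, 'b) monoid_scheme \<Rightarrow> 'a set"
  where "torsion_part G = {x \<in> carrier G. \<exists>m::nat. m > 0 \<and> x [^]\<^bsub>G\<^esub> m = \<one>\<^bsub>G\<^esub>}"

definition torsion_subgroup :: "('a, 'b) monoid_scheme \<Rightarrow> ('a, 'b) monoid_scheme"
  where "torsion_subgroup G = G\<lparr>carrier := torsion_part G\<rparr>"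

definition p_torsion_part :: "nat \<Rightarrow> ('a, 'b) monoid_scheme \<Rightarrow> 'a set"
  where "p_torsion_part p G = {x \<in> carrier G. \<exists>k::nat. x [^]\<^bsub>G\<^esub> (p ^ k) = \<one>\<^bsub>G\<^esub>}"

definition bounded_p_torsion :: "nat \<Rightarrow> ('a, 'b) monoid_scheme \<Rightarrow> bool"
  where "bounded_p_torsion p G \<longleftrightarrow>
    (\<exists>k::nat. \<forall>x \<in> p_torsion_part p G. x [^]\<^bsub>G\<^esub> (p ^ k) = \<one>\<^bsub>G\<^esub>)"


subsection \<open>Strongly Hopfian groups\<close>

definition SH_exponent :: "('a, 'b) monoid_scheme \<Rightarrow> ('a \<Rightarrow> 'a) \<Rightarrow> nat \<Rightarrow> bool"
  where "SH_exponent G \<phi> n \<longleftrightarrow> n > 0 \<and> inj_on \<phi> ((\<phi> ^^ n) ` carrier G)"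

definition strongly_Hopfian :: "('a, 'b) monoid_scheme \<Rightarrow> bool"
  where "strongly_Hopfian G \<longleftrightarrow> (\<forall>\<phi> \<in> hom G G. \<exists>n. SH_exponent G \<phi> n)"

definition uniformly_strongly_Hopfian :: "('a, 'b) monoid_scheme \<Rightarrow> bool"
  where "uniformly_strongly_Hopfian G \<longleftrightarrow> (\<exists>n. \<forall>\<phi> \<in> hom G G. SH_exponent G \<phi> n)"


subsection \<open>Torsion-free rank\<close>

text \<open>Linear independence over the integers. Taking singletons for \<open>F\<close> shows that every element of
  an independent set has infinite order. The torsion-free rank is the common cardinality of the
  maximal independent sets; only finite ranks are needed.\<close>

definition int_independent :: "('a, 'b) monoid_scheme \<Rightarrow> 'a set \<Rightarrow> bool"
  where "int_independent G S \<longleftrightarrow> S \<subseteq> carrier G \<and>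
    (\<forall>F c. finite F \<and> F \<subseteq> S \<and> finprod G (\<lambda>x. x [^]\<^bsub>G\<^esub> (c x :: int)) F = \<one>\<^bsub>G\<^esub>
       \<longrightarrow> (\<forall>x\<in>F. c x = 0))"

definition has_torsion_free_rank :: "('a, 'b) monoid_scheme \<Rightarrow> nat \<Rightarrow> bool"
  where "has_torsion_free_rank G r \<longleftrightarrow>
    (\<exists>S. int_independent G S \<and> (\<forall>S'. int_independent G S' \<and> S \<subseteq> S' \<longrightarrow> S' = S) \<and>
         finite S \<and> card S = r)"


subsection \<open>Warfield groups\<close>

text \<open>In the free abelian group on \<open>X\<close>, the relators of the relations \<open>m x = 0\<close> and \<open>m x = y\<close>.\<close>

definition simple_relators :: "'x set \<Rightarrow> ('x \<Rightarrow>\<^sub>0 int) set"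
  where "simple_relators X =
    {frag_cmul m (frag_of x) | m x. x \<in> X} \<union>
    {frag_cmul m (frag_of x) - frag_of y | m x y. x \<in> X \<and> y \<in> X}"

definition presented_group :: "'x set \<Rightarrow> ('x \<Rightarrow>\<^sub>0 int) set \<Rightarrow> ('x \<Rightarrow>\<^sub>0 int) set monoid"
  where "presented_group X R = free_Abelian_group X Mod generate (free_Abelian_group X) R"

definition simply_presented :: "'x itself \<Rightarrow> ('a, 'b) monoid_scheme \<Rightarrow> bool"
  where "simply_presented (_ :: 'x itself) H \<longleftrightarrow> comm_group H \<and>
    (\<exists>(X :: 'x set) R. R \<subseteq> simple_relators X \<and> H \<cong> presented_group X R)"

definition direct_summand :: "'a set \<Rightarrow> ('a, 'b) monoid_scheme \<Rightarrow> bool"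
  where "direct_summand A H \<longleftrightarrow>
    (\<exists>B. subgroup A H \<and> subgroup B H \<and> A \<inter> B = {\<one>\<^bsub>H\<^esub>} \<and> A <#>\<^bsub>H\<^esub> B = carrier H)"

text \<open>A definition in HOL cannot quantify over types, so the type \<open>'x\<close> from which the generators are
  drawn is a parameter. It is unrestricted: in a theorem assuming \<open>Warfield_group TYPE('x) G\<close> the
  type variable \<open>'x\<close> is universally quantified, so generating sets of every size are covered.
  Up to isomorphism the simply presented group containing \<open>G\<close> can be taken to live on the carrier
  type of \<open>presented_group\<close>.\<close>

definition Warfield_group :: "'x itself \<Rightarrow> ('a, 'b) monoid_scheme \<Rightarrow> bool"
  where "Warfield_group (_ :: 'x itself) G \<longleftrightarrow> comm_group G \<and>
    (\<exists>(H :: ('x \<Rightarrow>\<^sub>0 int) set monoid) A.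
       simply_presented TYPE('x) H \<and> direct_summand A H \<and> G \<cong> H\<lparr>carrier := A\<rparr>)"


subsection \<open>The class B and its preorder\<close>

definition class_B :: "('a, 'b) monoid_scheme \<Rightarrow> bool"
  where "class_B G \<longleftrightarrow> comm_group G \<and> has_torsion_free_rank G 1 \<and>
    (\<forall>p. prime p \<longrightarrow> bounded_p_torsion p G)"

definition precsim :: "('a, 'b) monoid_scheme \<Rightarrow> ('c, 'd) monoid_scheme \<Rightarrow> bool"
    (infix \<open>\<lesssim>\<^sub>B\<close> 50)
  where "A \<lesssim>\<^sub>B A' \<longleftrightarrow> (\<exists>\<phi> \<in> hom A A'. \<not> \<phi> ` carrier A \<subseteq> torsion_part A')"

definition no_chain :: "'i set \<Rightarrow> ('i \<Rightarrow> ('a, 'b) monoid_scheme) \<Rightarrow> nat \<Rightarrow> bool"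
  where "no_chain I A n \<longleftrightarrow>
    \<not> (\<exists>i :: nat \<Rightarrow> 'i. inj_on i {1..n} \<and> i ` {1..n} \<subseteq> I \<and>
         (\<forall>k \<in> {1..<n}. A (i k) \<lesssim>\<^sub>B A (i (k + 1))))"

end

theory Submission
  imports Defs
begin

text \<open>
  Groups are written additively in the comments, and multiplicatively in the formulas.
  Write \<open>G\<close> for the direct sum of the \<open>A i\<close> and \<open>T\<close> for its torsion subgroup. Since every \<open>A i\<close>
  has torsion-free rank 1, a homomorphism \<open>A i \<rightarrow> A j\<close> with an image element of infinite order
  sends every element of infinite order to one of infinite order. Hence \<open>\<lesssim>\<^sub>B\<close> is a preorder on \<open>I\<close>,
  and a failure of the chain condition at length \<open>n\<close> is the existence of a list of \<open>n\<close> distinct indices,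
  any two of which are related in list order.

  If there are chains of every length, there are pairwise disjoint ones of every length: drop from
  a long chain the indices already used. Moving each summand of each chain to the next one and killing
  the last one defines an endomorphism of \<open>G\<close>. On a chain of length \<open>n + 1\<close> its \<open>n\<close>-th power is
  nonzero and its next power is zero, so it has no SH-exponent (\<open>not_strongly_Hopfian_if_chains\<close>).

  Conversely, suppose that there is no chain of length \<open>n\<close>, and let \<open>\<phi>\<close> be an endomorphism of \<open>G\<close>.
  If some \<open>\<phi>\<^sup>m y\<close> is torsion, then \<open>\<phi>\<close> to the power \<open>n * n\<close> already makes \<open>y\<close> torsion
  (\<open>torsion_after\<close>). Modulo torsion \<open>\<phi>\<close> is block triangular for the preorder. A block belongs to a class of
  equivalent indices. Such a class has fewer than \<open>n\<close> elements, so after tensoring with the rationals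
  the block acts on a space of dimension less than \<open>n\<close>, and a vector killed by some power is killed by
  the \<open>n\<close>-th power (\<open>nilpotent_layer\<close>). A strictly increasing sequence of classes has fewer than \<open>n\<close>
  members. If in addition \<open>T\<close> has a uniform
  exponent \<open>N\<close>, then \<open>N + n * n\<close> is a uniform exponent for \<open>G\<close>.

  It remains to relate the conditions on the torsion part. On a torsion group an SH-exponent
  can be tested on each \<open>p\<close>-torsion subgroup (\<open>SH_exponent_if_p_torsion\<close>). Multiplication by
  \<open>p\<close> shows that the \<open>p\<close>-torsion of a strongly Hopfian group is bounded. Bounded pure subgroups are direct
  summands (\<open>retraction_of_bounded_pure_subgroup\<close>), so endomorphisms of a \<open>p\<close>-torsion subgroup extend to the
  whole group; in particular a uniform exponent for \<open>G\<close> is one for \<open>T\<close>. Finally, a torsion group that is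
  strongly Hopfian is uniformly so (\<open>torsion_strongly_Hopfian_imp_uniformly\<close>). Each of its \<open>p\<close>-torsion
  subgroups is finite, since otherwise it would have an infinite direct sum of
  isomorphic cyclic groups as a summand, and this has a backward shift. So for each \<open>p\<close> there is an
  endomorphism of the \<open>p\<close>-torsion whose kernels grow for as long as possible, and all these combine
  into a single endomorphism; its exponent serves every other endomorphism.
\<close>

section \<open>Homomorphisms, iterates and products of subgroups\<close>

text \<open>An infinite family of homomorphisms can be added up if only finitely many of them are nontrivial
  at each argument.\<close>

lemma hom_pointwise_finite_sum:
  assumes "comm_group H" and f: "\<And>i. i \<in> P \<Longrightarrow> f i \<in> hom G H"
    and fin: "\<And>x. x \<in> carrier G \<Longrightarrow> finite {i \<in> P. f i x \<noteq> \<one>\<^bsub>H\<^esub>}"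
    and "group G"
  shows "(\<lambda>x. gfinprod H (\<lambda>i. f i x) P) \<in> hom G H"
proof -
  interpret H: comm_group H by fact
  interpret G: group G by fact
  have cl: "(\<lambda>i. f i x) \<in> P \<rightarrow> carrier H" if "x \<in> carrier G" for x
    using f that by (auto simp: hom_def)
  show ?thesis
  proof (rule homI)
    fix x y assume xy: "x \<in> carrier G" "y \<in> carrier G"
    have "gfinprod H (\<lambda>i. f i (x \<otimes>\<^bsub>G\<^esub> y)) P = gfinprod H (\<lambda>i. f i x \<otimes>\<^bsub>H\<^esub> f i y) P"
      using cl[OF xy(1)] cl[OF xy(2)]
      by (intro H.gfinprod_cong) (auto simp: simp_implies_def hom_mult[OF f] xy Pi_def)
    also have "\<dots> = gfinprod H (\<lambda>i. f i x) P \<otimes>\<^bsub>H\<^esub> gfinprod H (\<lambda>i. f i y) P"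
      using cl fin xy by (intro H.gfinprod_distrib) auto
    finally show "gfinprod H (\<lambda>i. f i (x \<otimes>\<^bsub>G\<^esub> y)) P
       = gfinprod H (\<lambda>i. f i x) P \<otimes>\<^bsub>H\<^esub> gfinprod H (\<lambda>i. f i y) P" .
  qed (use cl in auto)
qed

lemma gfinprod_single_index:
  assumes "comm_group H" "j \<in> P" "a \<in> carrier H" "\<And>i. i \<in> P \<Longrightarrow> i \<noteq> j \<Longrightarrow> f i = \<one>\<^bsub>H\<^esub>" "f j = a"
  shows "gfinprod H f P = a"
proof -
  interpret H: comm_group H by fact
  have "f i \<in> carrier H" if "i \<in> P" for i
    using assms(3-5) that by (cases "i = j") auto
  then have "gfinprod H f {j} = gfinprod H f P"
    using assms(2,4) by (intro H.gfinprod_mono_neutral_cong_left) auto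
  then show ?thesis using assms(3,5) by (simp add: Pi_def)
qed

lemma group_homI: "group G \<Longrightarrow> group H \<Longrightarrow> h \<in> hom G H \<Longrightarrow> group_hom G H h"
  by (simp add: group_hom_def group_hom_axioms_def)

lemma (in group) eq_if_mult_inv_one:
  assumes "x \<in> carrier G" "y \<in> carrier G" "x \<otimes> inv y = \<one>"
  shows "x = y"
  using inv_equality[OF assms(3)] assms by simp

context comm_group begin

lemma funpow_hom: "f \<in> hom G G \<Longrightarrow> f ^^ n \<in> hom G G"
  by (induction n) (auto simp: hom_def Pi_def)

lemma funpow_closed: "f \<in> hom G G \<Longrightarrow> x \<in> carrier G \<Longrightarrow> (f ^^ n) x \<in> carrier G"
  by (rule hom_in_carrier[OF funpow_hom])

lemma funpow_one: "f \<in> hom G G \<Longrightarrow> (f ^^ n) \<one> = \<one>"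
  by (rule hom_one[OF funpow_hom is_group is_group])

lemma SH_exponent_iff:
  assumes f: "f \<in> hom G G"
  shows "SH_exponent G f n \<longleftrightarrow> n > 0 \<and> (\<forall>x\<in>carrier G. (f ^^ Suc n) x = \<one> \<longrightarrow> (f ^^ n) x = \<one>)"
proof -
  have "inj_on f ((f ^^ n) ` carrier G) \<longleftrightarrow> (\<forall>x\<in>carrier G. (f ^^ Suc n) x = \<one> \<longrightarrow> (f ^^ n) x = \<one>)"
    (is "?l \<longleftrightarrow> ?r")
  proof
    assume ?l
    show ?r
    proof (intro ballI impI)
      fix x assume x: "x \<in> carrier G" "(f ^^ Suc n) x = \<one>"
      have "f ((f ^^ n) x) = f ((f ^^ n) \<one>)"
        using x f by (simp add: funpow_one hom_one)
      then show "(f ^^ n) x = \<one>"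
        using \<open>?l\<close> x f by (metis funpow_one imageI inj_onD one_closed)
    qed
  next
    assume r: ?r
    show ?l
    proof (rule inj_onI; clarify)
      fix x y assume xy: "x \<in> carrier G" "y \<in> carrier G" "f ((f ^^ n) x) = f ((f ^^ n) y)"
      let ?z = "x \<otimes> inv y"
      have hn: "(f ^^ k) ?z = (f ^^ k) x \<otimes> inv ((f ^^ k) y)" for k
      proof -
        interpret h: group_hom G G "f ^^ k"
          using funpow_hom[OF f] by unfold_locales
        show ?thesis using xy by simp
      qed
      have "(f ^^ Suc n) ?z = \<one>"
        using xy f by (subst hn) (simp add: hom_in_carrier funpow_closed)
      then have "(f ^^ n) ?z = \<one>" using r xy by simp
      then show "(f ^^ n) x = (f ^^ n) y"
        using hn[of n] xy f by (simp add: eq_if_mult_inv_one funpow_closed)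
    qed
  qed
  then show ?thesis unfolding SH_exponent_def by simp
qed

lemma SH_exponent_stable:
  assumes f: "f \<in> hom G G" and n: "SH_exponent G f n"
    and x: "x \<in> carrier G" and "(f ^^ m) x = \<one>"
  shows "(f ^^ n) x = \<one>"
proof (cases "n \<le> m")
  case True
  then have "(f ^^ (n + k)) x = \<one> \<Longrightarrow> (f ^^ n) x = \<one>" for k
  proof (induction k)
    case (Suc k)
    have "(f ^^ Suc n) ((f ^^ k) x) = \<one>"
      using Suc.prems by (metis add.commute add_Suc comp_apply funpow_add add_Suc_right)
    then have "(f ^^ n) ((f ^^ k) x) = \<one>"
      using n x f by (simp add: SH_exponent_iff funpow_closed)
    then show ?case using Suc by (simp add: funpow_add)
  qed simp
  then show ?thesis using True assms by (metis le_add_diff_inverse)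
next
  case False
  then obtain k where "n = k + m" by (metis add.commute le_add_diff_inverse nat_le_linear)
  then show ?thesis using assms by (simp add: funpow_add funpow_one)
qed

end

lemma set_mult_iff: "x \<in> H <#>\<^bsub>G\<^esub> K \<longleftrightarrow> (\<exists>h\<in>H. \<exists>k\<in>K. x = h \<otimes>\<^bsub>G\<^esub> k)"
  by (auto simp: set_mult_def)

lemma set_multI: "h \<in> H \<Longrightarrow> k \<in> K \<Longrightarrow> h \<otimes>\<^bsub>G\<^esub> k \<in> H <#>\<^bsub>G\<^esub> K"
  by (auto simp: set_mult_def)

lemma (in comm_group) subgroup_set_mult:
  assumes "subgroup H G" "subgroup K G"
  shows "subgroup (H <#> K) G"
proof -
  interpret H: subgroup H G by fact
  interpret K: subgroup K G by fact
  show ?thesis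
  proof (rule subgroupI)
    show "H <#> K \<subseteq> carrier G"
      by (rule set_mult_closed[OF H.subset K.subset])
  next
    have "\<one> \<otimes> \<one> \<in> H <#> K"
      by (rule set_multI[OF H.one_closed K.one_closed])
    then show "H <#> K \<noteq> {}" by blast
  next
    fix a assume "a \<in> H <#> K"
    then obtain h k where hk: "h \<in> H" "k \<in> K" "a = h \<otimes> k" by (auto simp: set_mult_def)
    then have "inv a = inv h \<otimes> inv k" by (simp add: inv_mult)
    with hk show "inv a \<in> H <#> K" unfolding set_mult_iff by blast
  next
    fix a b assume "a \<in> H <#> K" "b \<in> H <#> K"
    then obtain h k h' k' where hk: "h \<in> H" "k \<in> K" "a = h \<otimes> k" "h' \<in> H" "k' \<in> K" "b = h' \<otimes> k'"
      by (auto simp: set_mult_def)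
    then have "a \<otimes> b = (h \<otimes> h') \<otimes> (k \<otimes> k')" by (simp add: m_ac)
    with hk show "a \<otimes> b \<in> H <#> K" unfolding set_mult_iff by blast
  qed
qed

lemma (in subgroup) nat_pow_mem: "x \<in> H \<Longrightarrow> x [^] (n::nat) \<in> H"
  by (induction n) simp_all

lemma (in group) subgroup_int_pow_mem:
  assumes "subgroup H G" "x \<in> H"
  shows "x [^] (n::int) \<in> H"
  using subgroup.nat_pow_mem[OF assms] subgroup.m_inv_closed[OF assms(1)] by (simp only: int_pow_def2 split: if_split) blast


section \<open>Bounded pure subgroups are direct summands\<close>

text \<open>\<open>T\<close> is \<open>p\<close>-pure in \<open>G\<close>: an element of \<open>T\<close> that is \<open>p\<^sup>s\<close> times an element of \<open>G\<close> is
  already \<open>p\<^sup>s\<close> times an element of \<open>T\<close>.\<close>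

definition p_pure :: "nat \<Rightarrow> 'a set \<Rightarrow> ('a, 'b) monoid_scheme \<Rightarrow> bool"
  where "p_pure p T G \<longleftrightarrow> (\<forall>s::nat. \<forall>x\<in>carrier G. x [^]\<^bsub>G\<^esub> (p ^ s) \<in> T \<longrightarrow>
    (\<exists>t\<in>T. x [^]\<^bsub>G\<^esub> (p ^ s) = t [^]\<^bsub>G\<^esub> (p ^ s)))"

text \<open>The maximality argument below uses the following variant. If \<open>s\<close> is so large that \<open>p\<^sup>s\<close>
  annihilates \<open>T\<close>, the case \<open>x = 0\<close> says that \<open>C\<close> and \<open>T\<close> meet trivially; given that, the
  property says that the image of \<open>T\<close> in \<open>G / C\<close> is \<open>p\<close>-pure.\<close>

definition p_pure_modulo :: "nat \<Rightarrow> 'a set \<Rightarrow> 'a set \<Rightarrow> ('a, 'b) monoid_scheme \<Rightarrow> bool"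
  where "p_pure_modulo p T C G \<longleftrightarrow> (\<forall>s::nat. \<forall>x\<in>carrier G. \<forall>c\<in>C.
     x [^]\<^bsub>G\<^esub> (p ^ s) \<otimes>\<^bsub>G\<^esub> c \<in> T \<longrightarrow>
    (\<exists>t\<in>T. x [^]\<^bsub>G\<^esub> (p ^ s) \<otimes>\<^bsub>G\<^esub> c = t [^]\<^bsub>G\<^esub> (p ^ s)))"

lemma (in group) subset_set_mult_left:
  assumes "subgroup H G" "subgroup K G" shows "H \<subseteq> H <#> K"
proof
  fix x assume x: "x \<in> H"
  then have "x \<otimes> \<one> \<in> H <#> K" by (rule set_multI[OF _ subgroup.one_closed[OF assms(2)]])
  then show "x \<in> H <#> K" using subgroup.mem_carrier[OF assms(1) x] by simp
qed

lemma (in group) subset_set_mult_right: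
  assumes "subgroup H G" "subgroup K G" shows "K \<subseteq> H <#> K"
proof
  fix x assume x: "x \<in> K"
  then have "\<one> \<otimes> x \<in> H <#> K" by (rule set_multI[OF subgroup.one_closed[OF assms(1)]])
  then show "x \<in> H <#> K" using subgroup.mem_carrier[OF assms(2) x] by simp
qed

lemma (in group) subgroup_Union_chain:
  assumes "\<C> \<noteq> {}" "\<And>X. X \<in> \<C> \<Longrightarrow> subgroup X G" "\<And>X Y. X \<in> \<C> \<Longrightarrow> Y \<in> \<C> \<Longrightarrow> X \<subseteq> Y \<or> Y \<subseteq> X"
  shows "subgroup (\<Union>\<C>) G"
proof (rule subgroupI)
  show "\<Union>\<C> \<subseteq> carrier G" using assms(2) subgroup.subset by blast
  show "\<Union>\<C> \<noteq> {}" using assms(1,2) subgroup.one_closed by (metis UnionI empty_iff ex_in_conv)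
next
  fix a assume "a \<in> \<Union>\<C>"
  then show "inv a \<in> \<Union>\<C>" using assms(2) subgroup.m_inv_closed by (metis Union_iff)
next
  fix a b assume "a \<in> \<Union>\<C>" "b \<in> \<Union>\<C>"
  then obtain X Y where XY: "X \<in> \<C>" "Y \<in> \<C>" "a \<in> X" "b \<in> Y" by blast
  then obtain Z where "Z \<in> \<C>" "a \<in> Z" "b \<in> Z" using assms(3)[OF XY(1,2)] by blast
  then show "a \<otimes> b \<in> \<Union>\<C>" using assms(2) subgroup.m_closed by (metis Union_iff)
qed

text \<open>If \<open>p\<^sup>m\<close> is the exact order of \<open>g\<close> modulo \<open>D\<close>, then \<open>p\<^sup>m\<close> divides every \<open>a\<close> with \<open>a g \<in> D\<close>.\<close>

lemma (in comm_group) pow_mem_imp_dvd: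
  fixes p m :: nat and a :: int
  assumes p: "prime p" and D: "subgroup D G" and g: "g \<in> carrier G"
    and top: "g [^] (p ^ m) \<in> D" and below: "m > 0 \<Longrightarrow> g [^] (p ^ (m - 1)) \<notin> D"
    and a: "g [^] a \<in> D"
  shows "int p ^ m dvd a"
proof (rule ccontr)
  assume nd: "\<not> int p ^ m dvd a"
  then have m: "m > 0" by (cases m) auto
  have "gcd a (int p ^ m) dvd int p ^ m" by simp
  then obtain s where s: "s \<le> m" "gcd a (int p ^ m) = int p ^ s"
    using divides_primepow[of "int p" "gcd a (int p ^ m)" m] p by auto
  have "s \<noteq> m" using nd s by (metis gcd_dvd1)
  then have sm: "s \<le> m - 1" using s by simp
  obtain u v where uv: "u * a + v * int p ^ m = int p ^ s"
    using bezout_int[of a "int p ^ m"] s by auto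
  have e: "g [^] (int p ^ s) = (g [^] a) [^] u \<otimes> (g [^] (int p ^ m)) [^] v"
    using g by (simp add: int_pow_pow flip: int_pow_mult uv) (simp add: mult.commute)
  have "g [^] (int p ^ m) = g [^] (p ^ m)" by (metis int_pow_int of_nat_power)
  then have "g [^] (int p ^ s) \<in> D"
    unfolding e using top a D by (auto intro!: subgroup.m_closed subgroup_int_pow_mem)
  then have "(g [^] (int p ^ s)) [^] (int p ^ (m - 1 - s)) \<in> D"
    by (rule subgroup_int_pow_mem[OF D])
  also have "(g [^] (int p ^ s)) [^] (int p ^ (m - 1 - s)) = g [^] (int p ^ (m - 1))"
    using g sm m by (simp add: int_pow_pow flip: power_add)
  also have "\<dots> = g [^] (p ^ (m - 1))" by (metis int_pow_int of_nat_power)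
  finally show False using below m by blast
qed

text \<open>The induction step of the splitting theorem. Modulo \<open>C + T\<close> the element \<open>g\<close> has order exactly
  \<open>p\<^sup>m\<close>, the largest possible, and modulo \<open>C\<close> it has the same order. Then \<open>g\<close> can be adjoined
  to \<open>C\<close>.\<close>

lemma (in comm_group) p_pure_modulo_extend:
  fixes p m :: nat
  assumes p: "prime p" and T: "subgroup T G" and C: "subgroup C G"
    and pure: "p_pure_modulo p T C G"
    and g: "g \<in> carrier G" and gC: "g [^] (p ^ m) \<in> C"
    and below: "m > 0 \<Longrightarrow> g [^] (p ^ (m - 1)) \<notin> C <#> T"
    and top: "\<And>x. x \<in> carrier G \<Longrightarrow> x [^] (p ^ m) \<in> C <#> T"
  shows "p_pure_modulo p T (C <#> range (\<lambda>a::int. g [^] a)) G"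
  unfolding p_pure_modulo_def
proof (intro allI ballI impI)
  note D = subgroup_set_mult[OF C T]
  interpret C: subgroup C G by fact
  interpret T: subgroup T G by fact
  interpret D: subgroup "C <#> T" G by fact
  note CD = subset_set_mult_left[OF C T] and TD = subset_set_mult_right[OF C T]
  fix s :: nat and x c
  assume x: "x \<in> carrier G" and "c \<in> C <#> range (\<lambda>a::int. g [^] a)"
    and mem: "x [^] (p ^ s) \<otimes> c \<in> T"
  then obtain c' a where c: "c = c' \<otimes> g [^] a" and c': "c' \<in> C" and "a \<in> (UNIV::int set)"
    unfolding set_mult_def by blast
  have cc: "c' \<in> carrier G" using c' by simp
  have e: "x [^] (p ^ s) \<otimes> g [^] a = (x [^] (p ^ s) \<otimes> c) \<otimes> inv c'"
    using x g cc unfolding c by (subst inv_solve_right) (simp_all add: m_ac)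
  have xgD: "x [^] (p ^ s) \<otimes> g [^] a \<in> C <#> T"
    unfolding e by (rule D.m_closed[OF subsetD[OF TD mem] D.m_inv_closed[OF subsetD[OF CD c']]])
  have g2: "g [^] (p ^ m) \<in> C <#> T" using gC CD by blast
  note dvd = pow_mem_imp_dvd[OF p D g g2 below]
  show "\<exists>t\<in>T. x [^] (p ^ s) \<otimes> c = t [^] (p ^ s)"
  proof (cases "s \<le> m")
    case True
    have pw: "p ^ s * p ^ (m - s) = p ^ m" using True by (simp flip: power_add)
    have "(x [^] (p ^ s) \<otimes> g [^] a) [^] (p ^ (m - s)) \<in> C <#> T"
      by (rule D.nat_pow_mem[OF xgD])
    also have "(x [^] (p ^ s) \<otimes> g [^] a) [^] (p ^ (m - s)) = x [^] (p ^ m) \<otimes> g [^] (a * int p ^ (m - s))"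
      using x g pw int_pow_int[of G "g [^] a" "p ^ (m - s)"]
      by (simp add: nat_pow_distrib nat_pow_pow int_pow_pow flip: of_nat_power)
    finally have h: "x [^] (p ^ m) \<otimes> g [^] (a * int p ^ (m - s)) \<in> C <#> T" .
    have "inv (x [^] (p ^ m)) \<otimes> (x [^] (p ^ m) \<otimes> g [^] (a * int p ^ (m - s))) \<in> C <#> T"
      by (rule D.m_closed[OF D.m_inv_closed[OF top[OF x]] h])
    then have "g [^] (a * int p ^ (m - s)) \<in> C <#> T"
      using x g by (simp flip: m_assoc)
    then have "int p ^ m dvd a * int p ^ (m - s)" by (rule dvd[rotated])
    then have "int p ^ s * int p ^ (m - s) dvd a * int p ^ (m - s)"
      using True by (simp flip: power_add)
    then have "int p ^ s dvd a" using p by (simp add: prime_gt_0_nat)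
    then obtain b where b: "a = b * int p ^ s" by (metis dvdE mult.commute)
    have "g [^] a = (g [^] b) [^] (p ^ s)"
      using g by (simp add: b int_pow_pow flip: int_pow_int)
    then have "x [^] (p ^ s) \<otimes> c = (x \<otimes> g [^] b) [^] (p ^ s) \<otimes> c'"
      using x g cc by (simp add: c nat_pow_distrib m_ac)
    then show ?thesis
      using pure mem c' x g unfolding p_pure_modulo_def by simp
  next
    case False
    then have "x [^] (p ^ s) = (x [^] (p ^ m)) [^] (p ^ (s - m))"
      using x by (simp add: nat_pow_pow flip: power_add)
    then have "x [^] (p ^ s) \<in> C <#> T" using D.nat_pow_mem[OF top[OF x]] by simp
    then have "inv (x [^] (p ^ s)) \<otimes> (x [^] (p ^ s) \<otimes> g [^] a) \<in> C <#> T"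
      by (rule D.m_closed[OF D.m_inv_closed xgD])
    then have "g [^] a \<in> C <#> T"
      using x g by (simp flip: m_assoc)
    then have "int p ^ m dvd a" by (rule dvd[rotated])
    then obtain b where "a = int p ^ m * b" by (metis dvdE)
    then have "g [^] a = (g [^] (p ^ m)) [^] b"
      using g by (simp add: int_pow_pow flip: int_pow_int)
    then have "g [^] a \<in> C" using subgroup_int_pow_mem[OF C gC] by simp
    then have "c \<in> C" unfolding c using c' by blast
    then show ?thesis using pure mem x unfolding p_pure_modulo_def by blast
  qed
qed

lemma (in comm_group) retraction_of_complement:
  assumes C: "subgroup C G" and T: "subgroup T G" and triv: "C \<inter> T \<subseteq> {\<one>}"
    and full: "carrier G \<subseteq> C <#> T"
  obtains r where "r \<in> hom G G" "\<And>x. x \<in> carrier G \<Longrightarrow> r x \<in> T" "\<And>t. t \<in> T \<Longrightarrow> r t = t"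
proof -
  interpret C: subgroup C G by fact
  interpret T: subgroup T G by fact
  have "\<forall>x\<in>carrier G. \<exists>t. t \<in> T \<and> x \<otimes> inv t \<in> C"
  proof
    fix x assume "x \<in> carrier G"
    then obtain c t where ct: "c \<in> C" "t \<in> T" "x = c \<otimes> t" using full set_mult_iff by (metis subsetD)
    then have "x \<otimes> inv t = c" by (simp add: m_assoc)
    then show "\<exists>t. t \<in> T \<and> x \<otimes> inv t \<in> C" using ct by metis
  qed
  then obtain r where r: "\<And>x. x \<in> carrier G \<Longrightarrow> r x \<in> T" "\<And>x. x \<in> carrier G \<Longrightarrow> x \<otimes> inv r x \<in> C"
    by metis
  have uniq: "r x = t" if x: "x \<in> carrier G" and t: "t \<in> T" "x \<otimes> inv t \<in> C" for x t
  proof -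
    have tc: "t \<in> carrier G" "r x \<in> carrier G" using t r x by simp_all
    have "inv (x \<otimes> inv t) \<otimes> (x \<otimes> inv r x) \<in> C" using t r x by simp
    also have "inv (x \<otimes> inv t) \<otimes> (x \<otimes> inv r x) = (inv x \<otimes> x) \<otimes> (t \<otimes> inv r x)"
      using x tc by (simp only: inv_mult inv_inv inv_closed m_ac m_closed)
    also have "\<dots> = t \<otimes> inv r x" using x tc by simp
    finally have "t \<otimes> inv r x \<in> C" .
    moreover have "t \<otimes> inv r x \<in> T" using t r x by simp
    ultimately have "t \<otimes> inv r x = \<one>" using triv by blast
    then show ?thesis using eq_if_mult_inv_one tc by metis
  qed
  show ?thesis
  proof
    show "r t = t" if "t \<in> T" for t using that by (intro uniq) auto
    show "r \<in> hom G G"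
    proof (rule homI)
      fix x y assume xy: "x \<in> carrier G" "y \<in> carrier G"
      have rc: "r x \<in> carrier G" "r y \<in> carrier G" using r xy by simp_all
      have "(x \<otimes> y) \<otimes> inv (r x \<otimes> r y) = (x \<otimes> inv r x) \<otimes> (y \<otimes> inv r y)"
        using xy rc by (simp only: inv_mult inv_closed m_ac m_closed)
      also have "\<dots> \<in> C" using r xy by blast
      finally show "r (x \<otimes> y) = r x \<otimes> r y" using r xy by (intro uniq) auto
    qed (use r in auto)
  qed (use r in auto)
qed

text \<open>A \<open>p\<close>-pure subgroup \<open>T\<close> annihilated by \<open>p\<^sup>k\<close> is a direct summand. Its complement is a maximal
  subgroup \<open>C\<close> that contains \<open>p\<^sup>k G\<close> and modulo which \<open>T\<close> is still pure. If \<open>C + T\<close> were not all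
  of \<open>G\<close>, purity would lift an element of maximal order of \<open>G / (C + T)\<close> to an element of the same
  order of \<open>G / C\<close>, which could be adjoined to \<open>C\<close>.\<close>

theorem (in comm_group) retraction_of_bounded_pure_subgroup:
  fixes p k :: nat
  assumes p: "prime p" and T: "subgroup T G" and pure: "p_pure p T G"
    and bdd: "\<And>t. t \<in> T \<Longrightarrow> t [^] (p ^ k) = \<one>"
  obtains r where "r \<in> hom G G" "\<And>x. x \<in> carrier G \<Longrightarrow> r x \<in> T" "\<And>t. t \<in> T \<Longrightarrow> r t = t"
proof -
  interpret T: subgroup T G by fact
  define C0 where "C0 = (\<lambda>x. x [^] (p ^ k)) ` carrier G"
  define F where "F = {C. subgroup C G \<and> C0 \<subseteq> C \<and> p_pure_modulo p T C G}"
  have C0: "subgroup C0 G"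
  proof -
    interpret h: group_hom G G "\<lambda>x. x [^] (p ^ k)"
      by unfold_locales (auto simp: hom_def nat_pow_distrib)
    show ?thesis unfolding C0_def by (rule h.img_is_subgroup)
  qed
  have "p_pure_modulo p T C0 G"
    unfolding p_pure_modulo_def C0_def
  proof (intro allI ballI impI; clarify)
    fix s :: nat and x y
    assume x: "x \<in> carrier G" and y: "y \<in> carrier G" and mem: "x [^] (p ^ s) \<otimes> y [^] (p ^ k) \<in> T"
    show "\<exists>t\<in>T. x [^] (p ^ s) \<otimes> y [^] (p ^ k) = t [^] (p ^ s)"
    proof (cases "s \<le> k")
      case True
      then have "p ^ k = p ^ (k - s) * p ^ s" by (simp flip: power_add)
      then have e: "x [^] (p ^ s) \<otimes> y [^] (p ^ k) = (x \<otimes> y [^] (p ^ (k - s))) [^] (p ^ s)"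
        using x y by (simp add: nat_pow_distrib nat_pow_pow)
      show ?thesis using pure mem x y unfolding e p_pure_def by simp
    next
      case False
      then have "p ^ s = p ^ (s - k) * p ^ k" by (simp flip: power_add)
      then have e: "x [^] (p ^ s) \<otimes> y [^] (p ^ k) = (x [^] (p ^ (s - k)) \<otimes> y) [^] (p ^ k)"
        using x y by (simp add: nat_pow_distrib nat_pow_pow)
      obtain t where "t \<in> T" "x [^] (p ^ s) \<otimes> y [^] (p ^ k) = t [^] (p ^ k)"
        using pure mem x y unfolding e p_pure_def by (metis m_closed nat_pow_closed)
      then have "x [^] (p ^ s) \<otimes> y [^] (p ^ k) = \<one> [^] (p ^ s)" using bdd by simp
      then show ?thesis using T.one_closed by blast
    qed
  qed
  then have F0: "C0 \<in> F" using C0 by (simp add: F_def)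
  have "\<exists>M\<in>F. \<forall>X\<in>F. M \<subseteq> X \<longrightarrow> X = M"
  proof (rule subset_Zorn_nonempty)
    show "F \<noteq> {}" using F0 by blast
  next
    fix \<C> assume ne: "\<C> \<noteq> {}" and ch: "subset.chain F \<C>"
    have sub: "\<C> \<subseteq> F" and lin: "\<And>X Y. X \<in> \<C> \<Longrightarrow> Y \<in> \<C> \<Longrightarrow> X \<subseteq> Y \<or> Y \<subseteq> X"
      using ch by (auto simp: subset_chain_def)
    have "subgroup (\<Union>\<C>) G"
      by (rule subgroup_Union_chain[OF ne _ lin]) (use sub in \<open>auto simp: F_def\<close>)
    moreover have "C0 \<subseteq> \<Union>\<C>" using ne sub by (auto simp: F_def)
    moreover have "p_pure_modulo p T (\<Union>\<C>) G"
      unfolding p_pure_modulo_def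
    proof (intro allI ballI impI)
      fix s :: nat and x c
      assume h: "x \<in> carrier G" "c \<in> \<Union>\<C>" "x [^] (p ^ s) \<otimes> c \<in> T"
      then obtain C where "C \<in> F" "c \<in> C" using sub by blast
      then have "p_pure_modulo p T C G" by (simp add: F_def)
      then show "\<exists>t\<in>T. x [^] (p ^ s) \<otimes> c = t [^] (p ^ s)"
        using h \<open>c \<in> C\<close> unfolding p_pure_modulo_def by blast
    qed
    ultimately show "\<Union>\<C> \<in> F" by (simp add: F_def)
  qed
  then obtain C where CF: "C \<in> F" and max: "\<And>X. X \<in> F \<Longrightarrow> C \<subseteq> X \<Longrightarrow> X = C" by blast
  have C: "subgroup C G" and C0C: "C0 \<subseteq> C" and pC: "p_pure_modulo p T C G"
    using CF by (auto simp: F_def)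
  interpret C: subgroup C G by fact
  note D = subgroup_set_mult[OF C T]
  interpret D: subgroup "C <#> T" G by fact
  note CD = subset_set_mult_left[OF C T] and TD = subset_set_mult_right[OF C T]
  have triv: "C \<inter> T \<subseteq> {\<one>}"
  proof
    fix c assume c: "c \<in> C \<inter> T"
    then have "\<one> [^] (p ^ k) \<otimes> c \<in> T" by simp
    then obtain t where "t \<in> T" "\<one> [^] (p ^ k) \<otimes> c = t [^] (p ^ k)"
      using pC c unfolding p_pure_modulo_def by blast
    then show "c \<in> {\<one>}" using bdd c by simp
  qed
  have "carrier G \<subseteq> C <#> T"
  proof -
    define P where "P m \<longleftrightarrow> (\<forall>x\<in>carrier G. x [^] (p ^ m) \<in> C <#> T)" for m :: nat
    define m where "m = (LEAST m. P m)"
    have "P k" unfolding P_def using C0C CD C0_def by blast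
    then have Pm: "P m" unfolding m_def by (rule LeastI)
    have "m = 0"
    proof (rule ccontr)
      assume "m \<noteq> 0"
      then have m0: "m > 0" by simp
      then have "\<not> P (m - 1)" unfolding m_def by (intro not_less_Least) simp
      then obtain g0 where g0: "g0 \<in> carrier G" "g0 [^] (p ^ (m - 1)) \<notin> C <#> T"
        unfolding P_def by blast
      have "g0 [^] (p ^ m) \<in> C <#> T" using Pm g0 unfolding P_def by blast
      then obtain c t where ct: "c \<in> C" "t \<in> T" "g0 [^] (p ^ m) = c \<otimes> t"
        unfolding set_mult_iff by blast
      have cc: "c \<in> carrier G" "t \<in> carrier G" using ct by simp_all
      have "g0 [^] (p ^ m) \<otimes> inv c = t"
        unfolding ct(3) using cc by (metis inv_solve_right m_closed m_comm)
      then have "\<exists>t'\<in>T. g0 [^] (p ^ m) \<otimes> inv c = t' [^] (p ^ m)"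
        using pC g0 ct unfolding p_pure_modulo_def by (metis C.m_inv_closed)
      then obtain t' where t': "t' \<in> T" "t = t' [^] (p ^ m)"
        using \<open>g0 [^] (p ^ m) \<otimes> inv c = t\<close> by blast
      have tc: "t' \<in> carrier G" using t' by simp
      \<comment> \<open>Purity corrects \<open>g0\<close> by an element of \<open>T\<close>, so that its order modulo \<open>C\<close> drops to \<open>p\<^sup>m\<close>.\<close>
      define g where "g = g0 \<otimes> inv t'"
      have g: "g \<in> carrier G" using g0 tc by (simp add: g_def)
      have "g [^] (p ^ m) = g0 [^] (p ^ m) \<otimes> inv t"
        using g0 tc t' by (simp add: g_def nat_pow_distrib nat_pow_inv)
      also have "\<dots> = c" unfolding ct(3) using cc by (simp add: m_assoc)
      finally have gC: "g [^] (p ^ m) \<in> C" using ct by simp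
      have g': "g [^] (p ^ (m - 1)) \<notin> C <#> T"
      proof
        assume a: "g [^] (p ^ (m - 1)) \<in> C <#> T"
        have "t' [^] (p ^ (m - 1)) \<in> C <#> T"
          using T.nat_pow_mem[OF t'(1)] TD by blast
        then have "g [^] (p ^ (m - 1)) \<otimes> t' [^] (p ^ (m - 1)) \<in> C <#> T"
          using a by (rule D.m_closed[rotated])
        also have "g [^] (p ^ (m - 1)) \<otimes> t' [^] (p ^ (m - 1)) = g0 [^] (p ^ (m - 1))"
          using g0 tc g by (simp add: g_def m_assoc flip: nat_pow_distrib)
        finally show False using g0 by blast
      qed
      let ?R = "range (\<lambda>a::int. g [^] a)"
      have R: "subgroup ?R G"
      proof -
        have "?R = generate G {g}" using g generate_pow[OF g] by auto
        then show ?thesis using generate_is_subgroup[of "{g}"] g by simp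
      qed
      have "p_pure_modulo p T (C <#> ?R) G"
        by (rule p_pure_modulo_extend[OF p T C pC g gC g']) (use Pm in \<open>auto simp: P_def\<close>)
      moreover have CR: "C \<subseteq> C <#> ?R" by (rule subset_set_mult_left[OF C R])
      ultimately have "C <#> ?R \<in> F"
        using subgroup_set_mult[OF C R] C0C unfolding F_def by blast
      then have "C <#> ?R = C" using max CR by blast
      moreover have "g [^] (1::int) \<in> C <#> ?R"
        using subset_set_mult_right[OF C R] by blast
      ultimately have "g \<in> C" using g by (simp add: int_pow_1)
      then have "g [^] (p ^ (m - 1)) \<in> C" by (rule C.nat_pow_mem)
      then show False using g' CD by blast
    qed
    then show ?thesis using Pm by (auto simp: P_def)
  qed
  then show ?thesis using retraction_of_complement[OF C T triv] that by blast
qed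


section \<open>Finiteness of bounded p-torsion\<close>

lemma (in comm_group) subgroup_torsion_part: "subgroup (torsion_part G) G"
proof (rule subgroupI)
  show "torsion_part G \<noteq> {}"
    using one_closed nat_pow_one[of "Suc 0"] by (auto simp: torsion_part_def intro!: exI[of _ \<one>] exI[of _ "Suc 0"])
next
  fix a assume "a \<in> torsion_part G"
  then show "inv a \<in> torsion_part G" by (auto simp: torsion_part_def nat_pow_inv)
next
  fix a b assume "a \<in> torsion_part G" "b \<in> torsion_part G"
  then obtain m n :: nat where "m > 0" "n > 0" "a \<in> carrier G" "b \<in> carrier G" "a [^] m = \<one>" "b [^] n = \<one>"
    by (auto simp: torsion_part_def)
  moreover from this have "a [^] (m * n) = \<one>" "b [^] (m * n) = \<one>"
    by (metis nat_pow_one nat_pow_pow, metis mult.commute nat_pow_one nat_pow_pow)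
  ultimately show "a \<otimes> b \<in> torsion_part G"
    unfolding torsion_part_def by (auto simp: nat_pow_distrib intro!: exI[of _ "m * n"])
qed (auto simp: torsion_part_def)

lemma (in comm_group) subgroup_p_torsion_part: "subgroup (p_torsion_part p G) G"
proof (rule subgroupI)
  show "p_torsion_part p G \<noteq> {}"
    using one_closed by (auto simp: p_torsion_part_def)
next
  fix a assume "a \<in> p_torsion_part p G"
  then show "inv a \<in> p_torsion_part p G" by (auto simp: p_torsion_part_def nat_pow_inv)
next
  fix a b assume "a \<in> p_torsion_part p G" "b \<in> p_torsion_part p G"
  then obtain m n :: nat where "a \<in> carrier G" "b \<in> carrier G" "a [^] (p ^ m) = \<one>" "b [^] (p ^ n) = \<one>"
    by (auto simp: p_torsion_part_def)
  moreover from this have "a [^] (p ^ (m + n)) = \<one>" "b [^] (p ^ (m + n)) = \<one>"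
    by (metis nat_pow_one nat_pow_pow power_add, metis mult.commute nat_pow_one nat_pow_pow power_add)
  ultimately show "a \<otimes> b \<in> p_torsion_part p G"
    unfolding p_torsion_part_def by (auto simp: nat_pow_distrib intro!: exI[of _ "m + n"])
qed (auto simp: p_torsion_part_def)

lemma (in comm_group) p_torsion_part_root:
  assumes "x \<in> carrier G" "x [^] (p ^ s) \<in> p_torsion_part p G"
  shows "x \<in> p_torsion_part p G"
  using assms by (auto simp: p_torsion_part_def nat_pow_pow simp flip: power_add)

lemma (in comm_group) p_pure_p_torsion_part: "p_pure p (p_torsion_part p G) G"
  unfolding p_pure_def
proof (intro allI ballI impI)
  fix s x assume "x \<in> carrier G" "x [^] (p ^ s) \<in> p_torsion_part p G"
  then have "x \<in> p_torsion_part p G" by (rule p_torsion_part_root)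
  then show "\<exists>t\<in>p_torsion_part p G. x [^] (p ^ s) = t [^] (p ^ s)" by blast
qed

lemma (in comm_group) finite_generate_bounded:
  fixes q :: nat
  assumes "finite X" "X \<subseteq> carrier G" "q > 0" "\<And>x. x \<in> X \<Longrightarrow> x [^] q = \<one>"
  shows "finite (generate G X)"
  using assms(1,2,4)
proof (induction X rule: finite_induct)
  case empty
  then show ?case by (simp add: generate_empty)
next
  case (insert x X)
  have x: "x \<in> carrier G" "x [^] q = \<one>" and X: "X \<subseteq> carrier G" using insert.prems by auto
  have sx: "subgroup (generate G {x}) G" and sX: "subgroup (generate G X) G"
    using x X by (auto intro: generate_is_subgroup)
  have "generate G {x} \<subseteq> (\<lambda>i::nat. x [^] i) ` {..<q}"
  proof
    fix y assume "y \<in> generate G {x}"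
    then obtain a :: int where a: "y = x [^] a" using generate_pow[OF x(1)] by auto
    have "x [^] a = (x [^] q) [^] (a div int q) \<otimes> x [^] (a mod int q)"
      using x(1) by (simp add: int_pow_pow flip: int_pow_mult int_pow_int)
    also have "\<dots> = x [^] (nat (a mod int q))"
      using x assms(3) by (simp flip: int_pow_int)
    finally have "y = x [^] (nat (a mod int q))" using a by simp
    moreover have "nat (a mod int q) < q" using assms(3) by (simp add: nat_less_iff)
    ultimately show "y \<in> (\<lambda>i::nat. x [^] i) ` {..<q}" by blast
  qed
  then have fx: "finite (generate G {x})" by (rule finite_subset) simp
  have "generate G (insert x X) \<subseteq> generate G {x} <#> generate G X"
  proof (rule generate_subgroup_incl[OF _ subgroup_set_mult[OF sx sX]])
    show "insert x X \<subseteq> generate G {x} <#> generate G X"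
      using subset_set_mult_left[OF sx sX] subset_set_mult_right[OF sx sX]
        generate.incl[of x "{x}" G] generate.incl[of _ X G] by blast
  qed
  moreover have "finite (generate G {x} <#> generate G X)"
    using fx insert.IH insert.prems X by (auto simp: set_mult_def)
  ultimately show ?case by (rule finite_subset)
qed

lemma frag_divide:
  assumes "q \<noteq> 0" "\<And>i. q dvd poly_mapping.lookup c i"
  obtains d where "c = frag_cmul q d"
proof
  show "c = frag_cmul q (Poly_Mapping.map (\<lambda>a. a div q) c)"
  proof (rule poly_mapping_eqI)
    fix i
    have "poly_mapping.lookup (Poly_Mapping.map (\<lambda>a. a div q) c) i = poly_mapping.lookup c i div q"
      by (simp add: Poly_Mapping.map.rep_eq when_def)
    then show "poly_mapping.lookup c i = poly_mapping.lookup (frag_cmul q (Poly_Mapping.map (\<lambda>a. a div q) c)) i"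
      using assms(2)[of i] by simp
  qed
qed

text \<open>A sequence \<open>x\<close> of elements that generate an infinite direct sum of cyclic groups of order \<open>p\<^sup>m\<close>:
  each \<open>p\<^bsup>m - 1\<^esup> x i\<close> lies outside the subgroup generated by the earlier terms and \<open>Q\<close>. The subgroup
  \<open>Q\<close> contains every element of the generated group that is divisible by \<open>p\<^sup>m\<close> in \<open>G\<close>. The
  homomorphism \<open>e\<close> evaluates formal integer combinations of the sequence, so its range is the subgroup
  generated by the sequence.\<close>

locale homogeneous_sequence = comm_group G for G (structure) +
  fixes p m :: nat and x :: "nat \<Rightarrow> 'a" and Q and e :: "(nat \<Rightarrow>\<^sub>0 int) \<Rightarrow> 'a"
  assumes p: "prime p" and m: "m > 0" and x_closed: "x i \<in> carrier G"
    and x_pow: "x i [^] (p ^ m) = \<one>"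
    and Q: "subgroup Q G" and x_new: "x i [^] (p ^ (m - 1)) \<notin> generate G (x ` {..<i}) <#> Q"
    and e: "e \<in> hom (free_Abelian_group UNIV) G" and e_of: "e (frag_of i) = x i"
    and Q_div: "g \<in> carrier G \<Longrightarrow> g [^] (p ^ m) \<in> range e \<Longrightarrow> g [^] (p ^ m) \<in> Q"
begin

sublocale e: group_hom "free_Abelian_group (UNIV :: nat set)" G e
  by (rule group_homI) (simp_all add: e)

lemma e_closed: "e c \<in> carrier G"
  using e.hom_closed[of c] by simp

lemma e_add: "e (c + d) = e c \<otimes> e d"
  using e.hom_mult[of c d] by simp

lemma e_diff: "e (c - d) = e c \<otimes> inv (e d)"
  using e_add[of c "- d"] e.hom_inv[of d] by simp

lemma e_cmul: "e (frag_cmul (int n) c) = e c [^] n"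
  using e.hom_nat_pow[of c n] by simp

lemma e_cmul_int: "e (frag_cmul a c) = e c [^] a"
  using e.hom_int_pow[of c a] by simp

lemma e_pow: "e c [^] (p ^ m) = \<one>"
proof (rule free_Abelian_group_induct[of c UNIV])
  fix a b assume "e a [^] (p ^ m) = \<one>" "e b [^] (p ^ m) = \<one>"
  then show "e (a - b) [^] (p ^ m) = \<one>"
    by (simp add: e_diff nat_pow_distrib nat_pow_inv e_closed)
qed (use e.hom_one in \<open>simp_all add: e_of x_pow\<close>)

lemma e_mem_generate: "Poly_Mapping.keys c \<subseteq> S \<Longrightarrow> e c \<in> generate G (x ` S)"
proof -
  have S: "subgroup (generate G (x ` S)) G" using x_closed by (intro generate_is_subgroup) auto
  assume "Poly_Mapping.keys c \<subseteq> S"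
  then show ?thesis
  proof (rule free_Abelian_group_induct)
    show "e 0 \<in> generate G (x ` S)" using e.hom_one subgroup.one_closed[OF S] by simp
  qed (simp_all add: e_diff subgroup.m_closed[OF S] subgroup.m_inv_closed[OF S] e_of generate.incl)
qed

text \<open>By the choice of \<open>x L\<close>, the top coefficient \<open>a\<close> of \<open>c\<close> is divisible by \<open>p\<^sup>m\<close>; its term then
  vanishes, and the remaining ones are treated by induction.\<close>

lemma independent_mod_Q:
  "Poly_Mapping.keys c \<subseteq> {..<L} \<Longrightarrow> e c \<in> Q \<Longrightarrow> int p ^ m dvd poly_mapping.lookup c i"
proof (induction L arbitrary: c)
  case 0
  then show ?case by simp
next
  case (Suc L)
  define a where "a = poly_mapping.lookup c L"
  define c' where "c' = c - frag_cmul a (frag_of L)"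
  have lc': "poly_mapping.lookup c' k = (if k = L then 0 else poly_mapping.lookup c k)" for k
    by (simp add: c'_def a_def lookup_minus)
  have kc': "Poly_Mapping.keys c' \<subseteq> {..<L}"
  proof
    fix k assume "k \<in> Poly_Mapping.keys c'"
    then have "k \<noteq> L" "k \<in> Poly_Mapping.keys c" by (auto simp: in_keys_iff lc' split: if_splits)
    then show "k \<in> {..<L}" using Suc.prems(1) by (auto simp: less_Suc_eq)
  qed
  have c: "c = c' + frag_cmul a (frag_of L)" by (simp add: c'_def)
  have ec: "e c = e c' \<otimes> x L [^] a" by (subst c) (simp only: e_add e_cmul_int e_of)
  let ?W = "generate G (x ` {..<L})"
  have W: "subgroup ?W G" using x_closed by (intro generate_is_subgroup) auto
  note D = subgroup_set_mult[OF W Q]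
  have "inv (e c') \<in> ?W" using e_mem_generate[OF kc'] subgroup.m_inv_closed[OF W] by blast
  then have "inv (e c') \<otimes> e c \<in> ?W <#> Q" using Suc.prems(2) by (rule set_multI)
  also have "inv (e c') \<otimes> e c = x L [^] a" using e_closed x_closed by (simp add: ec flip: m_assoc)
  finally have aD: "x L [^] a \<in> ?W <#> Q" .
  have dv: "int p ^ m dvd a"
    by (rule pow_mem_imp_dvd[OF p D x_closed _ x_new aD]) (simp add: x_pow subgroup.one_closed[OF D])
  then obtain b where "a = int (p ^ m) * b" by auto
  then have "x L [^] a = (x L [^] (int (p ^ m))) [^] b" using int_pow_pow[OF x_closed] by simp
  then have "x L [^] a = \<one>" by (simp only: int_pow_int x_pow int_pow_one)
  then have "e c' \<in> Q" using Suc.prems(2) ec e_closed by simp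
  then have "int p ^ m dvd poly_mapping.lookup c' i" by (rule Suc.IH[OF kc'])
  then show ?case using dv by (auto simp: lc' a_def split: if_splits)
qed

lemma independent: "e c \<in> Q \<Longrightarrow> int p ^ m dvd poly_mapping.lookup c i"
proof -
  obtain L where "Poly_Mapping.keys c \<subseteq> {..<L}" using finite_nat_iff_bounded finite_keys by blast
  then show "e c \<in> Q \<Longrightarrow> int p ^ m dvd poly_mapping.lookup c i" by (rule independent_mod_Q)
qed

lemma subgroup_range: "subgroup (range e) G"
  using e.img_is_subgroup by (simp add: free_Abelian_group_def)

text \<open>Both cases use \<open>independent\<close>: a combination that lands in \<open>Q\<close> is \<open>p\<^sup>m\<close> times another one.\<close>

lemma p_pure_range: "p_pure p (range e) G"
  unfolding p_pure_def
proof (intro allI ballI impI)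
  fix s g assume g: "g \<in> carrier G" and "g [^] (p ^ s) \<in> range e"
  then obtain c where c: "g [^] (p ^ s) = e c" by blast
  show "\<exists>t\<in>range e. g [^] (p ^ s) = t [^] (p ^ s)"
  proof (cases "s \<le> m")
    case True
    have pw: "p ^ s * p ^ (m - s) = p ^ m" using True by (simp flip: power_add)
    have "e (frag_cmul (int (p ^ (m - s))) c) = g [^] (p ^ m)"
      using g by (simp only: e_cmul flip: c) (simp add: nat_pow_pow pw)
    then have "e (frag_cmul (int (p ^ (m - s))) c) \<in> Q" using Q_div[OF g] by (metis rangeI)
    then have "int p ^ m dvd int p ^ (m - s) * poly_mapping.lookup c i" for i
      using independent[of "frag_cmul (int (p ^ (m - s))) c" i] by simp
    moreover have "int p ^ m = int p ^ (m - s) * int p ^ s" using True by (simp flip: power_add)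
    ultimately have "int p ^ s dvd poly_mapping.lookup c i" for i
      using p by (simp add: prime_gt_0_nat)
    then obtain d where "c = frag_cmul (int p ^ s) d" using frag_divide[of "int p ^ s" c] p by (auto simp: prime_gt_0_nat)
    then have "e c = e d [^] (p ^ s)" using e_cmul[of "p ^ s" d] by simp
    then show ?thesis using c by auto
  next
    case False
    then have "p ^ s = p ^ (s - m) * p ^ m" by (simp flip: power_add)
    then have eq: "g [^] (p ^ s) = (g [^] (p ^ (s - m))) [^] (p ^ m)" using g by (simp add: nat_pow_pow)
    then have "e c \<in> Q" using Q_div[of "g [^] (p ^ (s - m))"] g c by (metis nat_pow_closed rangeI)
    then obtain d where "c = frag_cmul (int p ^ m) d"
      using frag_divide[of "int p ^ m" c] p independent by (auto simp: prime_gt_0_nat)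
    then have "e c = \<one>" using e_cmul[of "p ^ m" d] e_pow by simp
    also have "\<dots> = e 0 [^] (p ^ s)" using e.hom_one by simp
    finally show ?thesis using c by auto
  qed
qed

text \<open>The backward shift \<open>x (i + 1) \<mapsto> x i\<close>, \<open>x 0 \<mapsto> 0\<close> on formal combinations. It descends to the
  subgroup generated by the sequence by \<open>shift_cong\<close>.\<close>

definition shift :: "(nat \<Rightarrow>\<^sub>0 int) \<Rightarrow> (nat \<Rightarrow>\<^sub>0 int)"
  where "shift = frag_extend (\<lambda>i. case i of 0 \<Rightarrow> 0 | Suc j \<Rightarrow> frag_of j)"

lemma shift_cong: "e c = e d \<Longrightarrow> e (shift c) = e (shift d)"
proof -
  assume "e c = e d"
  then have "e (c - d) = \<one>" by (simp add: e_diff e_closed)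
  then have "e (c - d) \<in> Q" using subgroup.one_closed[OF Q] by simp
  then obtain b where "c - d = frag_cmul (int p ^ m) b"
    using frag_divide[of "int p ^ m" "c - d"] p independent by (auto simp: prime_gt_0_nat)
  then have "shift c - shift d = frag_cmul (int (p ^ m)) (shift b)"
    by (simp add: shift_def flip: frag_extend_diff frag_extend_cmul)
  then have "e (shift c - shift d) = \<one>" by (simp only: e_cmul e_pow)
  then show "e (shift c) = e (shift d)"
    by (simp add: eq_if_mult_inv_one e_closed e_diff)
qed

lemma not_strongly_Hopfian: "\<not> strongly_Hopfian G"
proof
  assume SH: "strongly_Hopfian G"
  have bdd: "t [^] (p ^ m) = \<one>" if "t \<in> range e" for t using that e_pow by blast
  obtain r where r: "r \<in> hom G G" "\<And>x. x \<in> carrier G \<Longrightarrow> r x \<in> range e" "\<And>t. t \<in> range e \<Longrightarrow> r t = t"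
    using retraction_of_bounded_pure_subgroup[OF p subgroup_range p_pure_range bdd] by blast
  define \<Phi> where "\<Phi> g = e (shift (SOME c. e c = r g))" for g
  have \<Phi>: "\<Phi> g = e (shift c)" if "r g = e c" for g c
    unfolding \<Phi>_def by (rule shift_cong) (metis (mono_tags) someI that)
  have hom: "\<Phi> \<in> hom G G"
  proof (rule homI)
    fix g h assume gh: "g \<in> carrier G" "h \<in> carrier G"
    then obtain c d where cd: "r g = e c" "r h = e d" using r(2) by blast
    then have "r (g \<otimes> h) = e (c + d)" using r(1) gh by (simp add: hom_mult e_add)
    then have "\<Phi> (g \<otimes> h) = e (shift (c + d))" by (rule \<Phi>)
    then show "\<Phi> (g \<otimes> h) = \<Phi> g \<otimes> \<Phi> h"
      using cd by (simp add: \<Phi> shift_def frag_extend_add e_add)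
  qed (simp add: \<Phi>_def e_closed)
  have \<Phi>x: "\<Phi> (x i) = e (shift (frag_of i))" for i
    by (rule \<Phi>) (metis e_of r(3) rangeI)
  have \<Phi>0: "\<Phi> (x 0) = \<one>" unfolding \<Phi>x shift_def frag_extend_of using e.hom_one by simp
  have \<Phi>S: "\<Phi> (x (Suc i)) = x i" for i by (simp add: \<Phi>x shift_def e_of)
  have it: "(\<Phi> ^^ n) (x n) = x 0" for n
    by (induction n) (simp_all add: \<Phi>S funpow_Suc_right del: funpow.simps)
  obtain n where n: "SH_exponent G \<Phi> n" using SH hom unfolding strongly_Hopfian_def by blast
  have "(\<Phi> ^^ Suc n) (x n) = \<one>" by (simp add: it \<Phi>0)
  then have "x 0 = \<one>" using n x_closed it by (simp only: SH_exponent_iff[OF hom]) metis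
  then have "x 0 [^] (p ^ (m - 1)) = \<one>" by simp
  moreover have "\<one> \<in> generate G (x ` {..<0}) <#> Q"
    by (rule subgroup.one_closed[OF subgroup_set_mult[OF _ Q]]) (simp add: generate_is_subgroup)
  ultimately show False using x_new[of 0] by simp
qed

end

text \<open>Suppose that the \<open>p\<close>-torsion \<open>T\<close> is bounded and infinite. Then \<open>p\<^sup>j T\<close> is infinite and
  \<open>p\<^bsup>j + 1\<^esup> T\<close> finite for some \<open>j\<close>. So \<open>p\<^sup>j T\<close> has infinitely many elements of order \<open>p\<close>, while the
  sum of \<open>p\<^bsup>j + 1\<^esup> T\<close> and any finite subgroup is finite; this leaves room to choose a homogeneous
  sequence for \<open>m = j + 1\<close> term by term.\<close>

theorem (in comm_group) finite_p_torsion_part_of_strongly_Hopfian: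
  fixes p k :: nat
  assumes SH: "strongly_Hopfian G" and p: "prime p"
    and bdd: "\<And>t. t \<in> p_torsion_part p G \<Longrightarrow> t [^] (p ^ k) = \<one>"
  shows "finite (p_torsion_part p G)"
proof (rule ccontr)
  let ?T = "p_torsion_part p G"
  assume inf: "infinite ?T"
  interpret T: subgroup ?T G by (rule subgroup_p_torsion_part)
  define pw where "pw j = (\<lambda>t. t [^] (p ^ j)) ` ?T" for j :: nat
  have "pw k \<subseteq> {\<one>}" using bdd by (auto simp: pw_def)
  then have fk: "finite (pw k)" by (rule finite_subset) simp
  have "pw 0 = ?T" by (force simp: pw_def)
  then obtain j where j: "infinite (pw j)" "finite (pw (Suc j))"
    using inf fk nat_induct[of "\<lambda>i. infinite (pw i)" k] by auto
  define m where "m = Suc j"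
  have pw_sub: "subgroup (pw i) G" for i
  proof -
    interpret h: group_hom "G\<lparr>carrier := ?T\<rparr>" G "\<lambda>x. x [^] (p ^ i)"
      by (rule group_homI) (auto simp: hom_def nat_pow_distrib T.subgroup_is_group[OF is_group])
    show ?thesis using h.img_is_subgroup by (simp add: pw_def)
  qed
  define S where "S = {y \<in> pw j. y [^] p = \<one>}"
  have "infinite S"
  proof
    assume fS: "finite S"
    have "(\<lambda>y. y [^] p) ` pw j \<subseteq> pw (Suc j)"
      by (auto simp: pw_def nat_pow_pow mult.commute)
    then have "finite ((\<lambda>y. y [^] p) ` pw j)" using j(2) finite_subset by blast
    moreover have "finite {y \<in> pw j. y [^] p = z}" for z
    proof (cases "\<exists>y0 \<in> pw j. y0 [^] p = z")
      case True
      then obtain y0 where y0: "y0 \<in> pw j" "y0 [^] p = z" by blast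
      have "{y \<in> pw j. y [^] p = z} \<subseteq> (\<lambda>s. s \<otimes> y0) ` S"
      proof
        fix y assume y: "y \<in> {y \<in> pw j. y [^] p = z}"
        have c: "y \<in> carrier G" "y0 \<in> carrier G"
          using y y0 subgroup.mem_carrier[OF pw_sub] by blast+
        have "y \<otimes> inv y0 \<in> pw j"
          using y y0 subgroup.m_closed[OF pw_sub] subgroup.m_inv_closed[OF pw_sub] by blast
        moreover have "(y \<otimes> inv y0) [^] p = \<one>"
          using y y0 c nat_pow_closed[OF c(2), of p] by (simp add: nat_pow_distrib nat_pow_inv)
        ultimately have "y \<otimes> inv y0 \<in> S" by (simp add: S_def)
        moreover have "y = (y \<otimes> inv y0) \<otimes> y0" using c by (simp add: m_assoc)
        ultimately show "y \<in> (\<lambda>s. s \<otimes> y0) ` S" by blast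
      qed
      then show ?thesis using fS finite_subset by blast
    next
      case False
      then have "{y \<in> pw j. y [^] p = z} = {}" by blast
      then show ?thesis by (simp only: finite.emptyI)
    qed
    ultimately have "finite (\<Union>z\<in>(\<lambda>y. y [^] p) ` pw j. {y \<in> pw j. y [^] p = z})"
      by (intro finite_UN_I)
    then have "finite (pw j)" by (rule rev_finite_subset) blast
    then show False using j(1) by blast
  qed
  define P where "P f i r \<longleftrightarrow> r \<in> ?T \<and> r [^] (p ^ m) = \<one> \<and>
     r [^] (p ^ j) \<notin> generate G (f ` {..<i}) <#> pw m" for f :: "nat \<Rightarrow> 'a" and i :: nat and r
  have "\<exists>x. \<forall>i. P x i (x i)"
  proof (rule dependent_wellorder_choice)
    fix r and f g :: "nat \<Rightarrow> 'a" and i :: nat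
    assume "\<And>y. y < i \<Longrightarrow> f y = g y"
    then have "f ` {..<i} = g ` {..<i}" by simp
    then show "P f i r = P g i r" by (simp add: P_def)
  next
    fix i and f :: "nat \<Rightarrow> 'a"
    assume prev: "\<And>y. y < i \<Longrightarrow> P f y (f y)"
    have "finite (generate G (f ` {..<i}))"
      by (rule finite_generate_bounded[of _ "p ^ m"])
        (use prev p in \<open>auto simp: P_def prime_gt_0_nat\<close>)
    then have "finite (generate G (f ` {..<i}) <#> pw m)"
      using j(2) by (auto simp: set_mult_def m_def)
    then obtain y where y: "y \<in> S" "y \<notin> generate G (f ` {..<i}) <#> pw m"
      using \<open>infinite S\<close> by (meson finite_subset subsetI)
    then obtain r where r: "r \<in> ?T" "y = r [^] (p ^ j)" by (auto simp: S_def pw_def)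
    then have "r [^] (p ^ m) = \<one>" using y by (simp add: S_def m_def nat_pow_pow mult.commute)
    then show "\<exists>r. P f i r" using r y unfolding P_def by blast
  qed
  then obtain x :: "nat \<Rightarrow> 'a" where xP: "\<And>i. P x i (x i)" by blast
  then have x: "\<And>i. x i \<in> ?T" "\<And>i. x i [^] (p ^ m) = \<one>"
    "\<And>i. x i [^] (p ^ j) \<notin> generate G (x ` {..<i}) <#> pw m"
    unfolding P_def by simp_all
  have xc: "x i \<in> carrier G" for i using x(1) by simp
  then have "range x \<subseteq> carrier G" by blast
  then obtain e where e: "e \<in> hom (free_Abelian_group UNIV) G" "\<And>i. e (frag_of i) = x i"
    using free_Abelian_group_universal[of x UNIV] by auto
  interpret eh: group_hom "free_Abelian_group (UNIV :: nat set)" G e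
    by (rule group_homI) (simp_all add: e)
  have eT: "e c \<in> ?T" for c
  proof (rule free_Abelian_group_induct[of c UNIV])
    fix a b assume "e a \<in> ?T" "e b \<in> ?T"
    moreover have "e (a - b) = e a \<otimes> inv (e b)"
      using eh.hom_mult[of a "- b"] eh.hom_inv[of b] by simp
    ultimately show "e (a - b) \<in> ?T" by simp
  qed (use eh.hom_one x in \<open>simp_all add: e\<close>)
  have div: "g [^] (p ^ m) \<in> pw m" if g: "g \<in> carrier G" and gm: "g [^] (p ^ m) \<in> range e" for g
  proof -
    obtain c where "g [^] (p ^ m) = e c" using gm by (rule rangeE)
    then have "g [^] (p ^ m) \<in> ?T" by (simp only: eT)
    then have "g \<in> ?T" by (rule p_torsion_part_root[OF g])
    then show ?thesis by (simp add: pw_def)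
  qed
  have "homogeneous_sequence G p m x (pw m) e"
  proof (intro homogeneous_sequence.intro comm_group_axioms homogeneous_sequence_axioms.intro)
    show "x i [^] (p ^ (m - 1)) \<notin> generate G (x ` {..<i}) <#> pw m" for i
      using x(3) by (simp add: m_def)
    show "m > 0" by (simp add: m_def)
  qed (simp_all add: p x xc e pw_sub div)
  then show False using homogeneous_sequence.not_strongly_Hopfian SH by blast
qed


section \<open>Uniform exponents on torsion groups\<close>

lemma (in group) eq_one_if_coprime_pow:
  fixes a b :: nat
  assumes x: "x \<in> carrier G" and "x [^] a = \<one>" "x [^] b = \<one>" "coprime a b"
  shows "x = \<one>"
proof -
  obtain u v where "u * int a + v * int b = 1"
    using assms(4) bezout_int[of "int a" "int b"] by (auto simp: coprime_iff_gcd_eq_1 simp flip: coprime_int_iff)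
  then have "x = x [^] (int a * u + int b * v)" using x by (simp add: mult.commute)
  also have "\<dots> = (x [^] int a) [^] u \<otimes> (x [^] int b) [^] v"
    using x by (simp only: int_pow_mult int_pow_pow)
  also have "\<dots> = \<one>" using assms by (simp add: int_pow_int)
  finally show ?thesis .
qed

lemma (in group) p_torsion_eq_one:
  fixes p N :: nat
  assumes "prime p" "z \<in> p_torsion_part p G" "z [^] N = \<one>" "\<not> p dvd N"
  shows "z = \<one>"
proof -
  obtain k where "z \<in> carrier G" "z [^] (p ^ k) = \<one>" using assms(2) by (auto simp: p_torsion_part_def)
  moreover have "coprime (p ^ k) N" using assms(1,4) by (simp add: prime_imp_coprime)
  ultimately show ?thesis using eq_one_if_coprime_pow assms(3) by blast
qed

lemma hom_p_torsion_part:
  assumes "f \<in> hom G H" "group G" "group H" "x \<in> p_torsion_part p G"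
  shows "f x \<in> p_torsion_part p H"
proof -
  obtain k where k: "x \<in> carrier G" "x [^]\<^bsub>G\<^esub> (p ^ k) = \<one>\<^bsub>G\<^esub>" using assms(4) by (auto simp: p_torsion_part_def)
  then have "f x [^]\<^bsub>H\<^esub> (p ^ k) = \<one>\<^bsub>H\<^esub>"
    using hom_nat_pow[OF assms(1) k(1) assms(2,3), of "p ^ k"] hom_one[OF assms(1-3)] by simp
  then show ?thesis using hom_in_carrier[OF assms(1) k(1)] by (auto simp: p_torsion_part_def)
qed

lemma hom_torsion_part:
  assumes "f \<in> hom G H" "group G" "group H" "x \<in> torsion_part G"
  shows "f x \<in> torsion_part H"
proof -
  obtain k :: nat where k: "x \<in> carrier G" "k > 0" "x [^]\<^bsub>G\<^esub> k = \<one>\<^bsub>G\<^esub>" using assms(4) by (auto simp: torsion_part_def)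
  then have "f x [^]\<^bsub>H\<^esub> k = \<one>\<^bsub>H\<^esub>"
    using hom_nat_pow[OF assms(1) k(1) assms(2,3), of k] hom_one[OF assms(1-3)] by simp
  then show ?thesis using k(2) hom_in_carrier[OF assms(1) k(1)] by (auto simp: torsion_part_def)
qed

context comm_group begin

lemma funpow_p_torsion_part:
  "f \<in> hom G G \<Longrightarrow> x \<in> p_torsion_part p G \<Longrightarrow> (f ^^ n) x \<in> p_torsion_part p G"
  by (rule hom_p_torsion_part[OF funpow_hom is_group is_group])

text \<open>Suppose that the exponent works on all \<open>p\<close>-torsion parts, and let \<open>x\<close> be killed by the \<open>(n + 1)\<close>-st
  power of \<open>f\<close> but not by the \<open>n\<close>-th. A multiple \<open>d' x\<close> has an \<open>n\<close>-th image of prime order \<open>p\<close>. A further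
  multiple of \<open>d' x\<close>, by a number prime to \<open>p\<close>, is \<open>p\<close>-torsion, hence is killed by the \<open>n\<close>-th
  power; so the image of \<open>d' x\<close> vanishes as well.\<close>

lemma SH_exponent_if_p_torsion:
  assumes tors: "carrier G \<subseteq> torsion_part G" and f: "f \<in> hom G G" and n: "n > 0"
    and loc: "\<And>p x. prime p \<Longrightarrow> x \<in> p_torsion_part p G \<Longrightarrow> (f ^^ Suc n) x = \<one> \<Longrightarrow> (f ^^ n) x = \<one>"
  shows "SH_exponent G f n"
  unfolding SH_exponent_iff[OF f]
proof (intro conjI n ballI impI)
  fix x assume x: "x \<in> carrier G" and fx: "(f ^^ Suc n) x = \<one>"
  have pw: "(f ^^ i) (x [^] (j::nat)) = (f ^^ i) x [^] j" for i j
    by (rule hom_nat_pow[OF funpow_hom[OF f] x is_group is_group])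
  define P where "P d \<longleftrightarrow> d > 0 \<and> (f ^^ n) x [^] d = \<one>" for d :: nat
  define d where "d = (LEAST d. P d)"
  have "(f ^^ n) x \<in> torsion_part G" using tors funpow_closed[OF f x] by blast
  then have "\<exists>d. P d" by (auto simp: P_def torsion_part_def)
  then have Pd: "P d" unfolding d_def by (metis LeastI)
  have "d = 1"
  proof (rule ccontr)
    assume "d \<noteq> 1"
    then obtain p where p: "prime p" "p dvd d" using prime_factor_nat by blast
    then obtain d' where d': "d = d' * p" by (metis dvdE mult.commute)
    have d'0: "d' > 0" using Pd d' by (simp add: P_def)
    have "d' < d" using d' d'0 prime_gt_1_nat[OF p(1)] by simp
    then have "\<not> P d'" unfolding d_def by (rule not_less_Least)
    then have ne: "(f ^^ n) (x [^] d') \<noteq> \<one>" using d'0 by (simp add: P_def pw)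
    have "x [^] d' \<in> torsion_part G" using tors x by blast
    then obtain N :: nat where N: "N > 0" "(x [^] d') [^] N = \<one>" by (auto simp: torsion_part_def)
    obtain k q where kq: "\<not> p dvd q" "N = q * p ^ k"
      using prime_power_canonical[OF p(1) N(1)] by blast
    define z where "z = (x [^] d') [^] q"
    have z: "z = x [^] (d' * q)" and zc: "z \<in> carrier G" using x by (simp_all add: z_def nat_pow_pow)
    have "z [^] (p ^ k) = \<one>" using N x by (simp add: z_def kq nat_pow_pow mult.assoc)
    then have "z \<in> p_torsion_part p G" using zc by (auto simp: p_torsion_part_def)
    moreover have "(f ^^ Suc n) z = \<one>" unfolding z pw using fx by simp
    ultimately have "(f ^^ n) z = \<one>" using loc p by blast
    then have "(f ^^ n) (x [^] d') [^] q = \<one>"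
      using f x unfolding z pw by (simp add: nat_pow_pow funpow_closed)
    moreover have "(f ^^ n) (x [^] d') [^] p = \<one>"
      using Pd f x unfolding pw by (simp add: nat_pow_pow funpow_closed P_def d')
    moreover have "coprime q p" using p kq by (metis coprime_commute prime_imp_coprime)
    ultimately show False
      using eq_one_if_coprime_pow[of "(f ^^ n) (x [^] d')" q p] ne f x by (simp add: funpow_closed)
  qed
  then show "(f ^^ n) x = \<one>" using Pd f x by (simp add: P_def funpow_closed)
qed

lemma pow_hom: "(\<lambda>x. x [^] (k::nat)) \<in> hom G G"
  by (auto simp: hom_def nat_pow_distrib)

lemma p_torsion_part_bounded:
  assumes n: "SH_exponent G (\<lambda>x. x [^] p) n" and t: "t \<in> p_torsion_part p G"
  shows "t [^] (p ^ n) = \<one>"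
proof -
  have it: "((\<lambda>x. x [^] p) ^^ i) t = t [^] (p ^ i)" for i
    using t by (induction i) (auto simp: p_torsion_part_def nat_pow_pow mult.commute)
  obtain k where "t [^] (p ^ k) = \<one>" using t by (auto simp: p_torsion_part_def)
  then show ?thesis
    using SH_exponent_stable[OF pow_hom n, of t k] t by (simp add: it p_torsion_part_def)
qed

lemma retraction_p_torsion_part:
  assumes "prime p" "SH_exponent G (\<lambda>x. x [^] p) n"
  obtains r where "r \<in> hom G G" "\<And>x. x \<in> carrier G \<Longrightarrow> r x \<in> p_torsion_part p G"
    "\<And>t. t \<in> p_torsion_part p G \<Longrightarrow> r t = t"
  using retraction_of_bounded_pure_subgroup[OF assms(1) subgroup_p_torsion_part p_pure_p_torsion_part
      p_torsion_part_bounded[OF assms(2)]] by blast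

end

lemma (in comm_group) comm_group_torsion_subgroup: "comm_group (torsion_subgroup G)"
  unfolding torsion_subgroup_def
  by (rule group.group_comm_groupI[OF subgroup.subgroup_is_group[OF subgroup_torsion_part is_group]])
    (auto simp: torsion_part_def m_comm)

theorem (in comm_group) uniformly_strongly_Hopfian_torsion_subgroup:
  assumes "uniformly_strongly_Hopfian G"
  shows "uniformly_strongly_Hopfian (torsion_subgroup G)"
proof -
  obtain n where n: "\<And>\<phi>. \<phi> \<in> hom G G \<Longrightarrow> SH_exponent G \<phi> n"
    using assms unfolding uniformly_strongly_Hopfian_def by blast
  define T where "T = torsion_subgroup G"
  have carrier_T: "carrier T = torsion_part G" and one_T: "\<one>\<^bsub>T\<^esub> = \<one>"
    and mult_T: "x \<otimes>\<^bsub>T\<^esub> y = x \<otimes> y" for x y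
    by (simp_all add: T_def torsion_subgroup_def)
  have pow_T: "x [^]\<^bsub>T\<^esub> k = x [^] k" for x and k :: nat
    by (simp add: T_def torsion_subgroup_def flip: nat_pow_consistent)
  interpret T: comm_group T
    unfolding T_def by (rule comm_group_torsion_subgroup)
  have "n > 0" using n[OF pow_hom[of 0]] by (simp add: SH_exponent_def)
  have "SH_exponent T \<phi> n" if \<phi>: "\<phi> \<in> hom T T" for \<phi>
  proof (rule T.SH_exponent_if_p_torsion[OF _ \<phi> \<open>n > 0\<close>])
    show "carrier T \<subseteq> torsion_part T"
      by (auto simp: carrier_T torsion_part_def pow_T one_T)
  next
    fix p x assume p: "prime p" and x: "x \<in> p_torsion_part p T" and \<phi>x: "(\<phi> ^^ Suc n) x = \<one>\<^bsub>T\<^esub>"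
    have TG: "p_torsion_part p T \<subseteq> p_torsion_part p G"
      by (auto simp: p_torsion_part_def carrier_T torsion_part_def pow_T one_T)
    have GT: "p_torsion_part p G \<subseteq> carrier T"
      using p by (auto simp: p_torsion_part_def carrier_T torsion_part_def prime_gt_0_nat intro!: exI[of _ "p ^ _"])
    obtain r where r: "r \<in> hom G G" "\<And>x. x \<in> carrier G \<Longrightarrow> r x \<in> p_torsion_part p G"
      "\<And>t. t \<in> p_torsion_part p G \<Longrightarrow> r t = t"
      using retraction_p_torsion_part[OF p n[OF pow_hom]] by blast
    define \<psi> where "\<psi> x = \<phi> (r x)" for x
    have \<psi>: "\<psi> \<in> hom G G"
    proof (rule homI)
      fix y assume "y \<in> carrier G"
      then have "\<phi> (r y) \<in> carrier T" using \<phi> r(2) GT by (meson hom_in_carrier subsetD)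
      then show "\<psi> y \<in> carrier G" by (simp add: \<psi>_def carrier_T torsion_part_def)
    next
      fix y z assume yz: "y \<in> carrier G" "z \<in> carrier G"
      then have "r y \<in> carrier T" "r z \<in> carrier T" using r(2) GT by blast+
      then show "\<psi> (y \<otimes> z) = \<psi> y \<otimes> \<psi> z"
        using hom_mult[OF r(1) yz] hom_mult[OF \<phi>, of "r y" "r z"] by (simp add: \<psi>_def mult_T)
    qed
    have it: "(\<psi> ^^ k) x = (\<phi> ^^ k) x" for k
    proof (induction k)
      case (Suc k)
      have "(\<phi> ^^ k) x \<in> p_torsion_part p G"
        using T.funpow_p_torsion_part[OF \<phi> x] TG by blast
      then show ?case using Suc r(3) by (simp add: \<psi>_def)
    qed simp
    have "x \<in> carrier G" using x TG by (auto simp: p_torsion_part_def)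
    then have "(\<psi> ^^ n) x = \<one>"
      using SH_exponent_stable[OF \<psi> n[OF \<psi>], of x "Suc n"] \<phi>x it one_T by metis
    then show "(\<phi> ^^ n) x = \<one>\<^bsub>T\<^esub>" using it one_T by simp
  qed
  then show ?thesis unfolding uniformly_strongly_Hopfian_def T_def by blast
qed

lemma uniformly_strongly_Hopfian_imp_strongly_Hopfian:
  "uniformly_strongly_Hopfian G \<Longrightarrow> strongly_Hopfian G"
  unfolding uniformly_strongly_Hopfian_def strongly_Hopfian_def by blast


text \<open>For each prime \<open>p\<close> the kernels of the powers of an endomorphism on the finite \<open>p\<close>-torsion part
  stabilise within a number of steps bounded by its size, so some endomorphism \<open>\<phi> p\<close> takes longest.
  The sum \<open>\<Phi>\<close> of the maps \<open>\<phi> p \<circ> \<pi> p\<close>, with \<open>\<pi> p\<close> a retraction onto the \<open>p\<close>-torsion part, is pointwise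
  finite and agrees with \<open>\<phi> p\<close> there. Hence any exponent of \<open>\<Phi>\<close> is an exponent of every
  endomorphism.\<close>

theorem (in comm_group) torsion_strongly_Hopfian_imp_uniformly:
  assumes tors: "carrier G \<subseteq> torsion_part G" and SH: "strongly_Hopfian G"
  shows "uniformly_strongly_Hopfian G"
proof -
  let ?T = "\<lambda>p. p_torsion_part p G"
  \<comment> \<open>\<open>bad p f N\<close>: on the \<open>p\<close>-torsion the kernel of the \<open>(N + 1)\<close>-st power of \<open>f\<close> exceeds that of the \<open>N\<close>-th.\<close>
  define bad where "bad p f N \<longleftrightarrow> (\<exists>x\<in>?T p. (f ^^ N) x \<noteq> \<one> \<and> (f ^^ Suc N) x = \<one>)" for p f N
  have "\<forall>p\<in>Collect prime. \<exists>r. r \<in> hom G G \<and> (\<forall>x\<in>carrier G. r x \<in> ?T p) \<and> (\<forall>t\<in>?T p. r t = t)"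
  proof
    fix p :: nat assume p: "p \<in> Collect prime"
    obtain n where n: "SH_exponent G (\<lambda>x. x [^] p) n"
      using SH pow_hom unfolding strongly_Hopfian_def by blast
    show "\<exists>r. r \<in> hom G G \<and> (\<forall>x\<in>carrier G. r x \<in> ?T p) \<and> (\<forall>t\<in>?T p. r t = t)"
      using retraction_p_torsion_part[OF _ n] p by (metis mem_Collect_eq)
  qed
  then obtain \<pi> where \<pi>: "\<And>p. prime p \<Longrightarrow> \<pi> p \<in> hom G G"
    "\<And>p x. prime p \<Longrightarrow> x \<in> carrier G \<Longrightarrow> \<pi> p x \<in> ?T p" "\<And>p t. prime p \<Longrightarrow> t \<in> ?T p \<Longrightarrow> \<pi> p t = t"
    by (metis mem_Collect_eq)
  have "\<exists>f\<in>hom G G. \<forall>N. \<forall>g\<in>hom G G. bad p g N \<longrightarrow> bad p f N" if p: "prime p" for p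
  proof -
    obtain n where n: "SH_exponent G (\<lambda>x. x [^] p) n"
      using SH pow_hom unfolding strongly_Hopfian_def by blast
    have fin: "finite (?T p)"
      by (rule finite_p_torsion_part_of_strongly_Hopfian[OF SH p p_torsion_part_bounded[OF n]])
    have bound: "N \<le> card (?T p)" if g: "g \<in> hom G G" and "bad p g N" for g N
    proof -
      obtain x where x: "x \<in> ?T p" "(g ^^ N) x \<noteq> \<one>" "(g ^^ Suc N) x = \<one>"
        using \<open>bad p g N\<close> by (auto simp: bad_def)
      have xc: "x \<in> carrier G" using x by (simp add: p_torsion_part_def)
      have lin: False if ij: "i < j" "j \<le> N" and eq: "(g ^^ i) x = (g ^^ j) x" for i j
      proof -
        have "(g ^^ (Suc N - j + i)) x = (g ^^ (Suc N - j)) ((g ^^ j) x)"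
          by (simp only: funpow_add comp_apply eq)
        also have "\<dots> = (g ^^ (Suc N - j + j)) x" by (simp only: funpow_add comp_apply)
        also have "Suc N - j + j = Suc N" using ij by simp
        finally have "(g ^^ (Suc N - j + i)) x = \<one>" using x by simp
        then have "(g ^^ (j - Suc i + (Suc N - j + i))) x = \<one>"
          using funpow_one[OF g] by (simp only: funpow_add comp_apply)
        moreover have "j - Suc i + (Suc N - j + i) = N" using ij by simp
        ultimately show False using x by simp
      qed
      have "inj_on (\<lambda>i. (g ^^ i) x) {..N}"
        unfolding inj_on_def using lin by (metis atMost_iff linorder_neqE_nat)
      moreover have "(\<lambda>i. (g ^^ i) x) ` {..N} \<subseteq> ?T p" using funpow_p_torsion_part[OF g x(1)] by blast
      ultimately have "card {..N} \<le> card (?T p)" using fin by (rule card_inj_on_le)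
      then show ?thesis by simp
    qed
    have down: "bad p g M" if "g \<in> hom G G" "bad p g N" "M \<le> N" for g M N
    proof -
      obtain x where x: "x \<in> ?T p" "(g ^^ N) x \<noteq> \<one>" "(g ^^ Suc N) x = \<one>"
        using \<open>bad p g N\<close> by (auto simp: bad_def)
      have "(g ^^ M) ((g ^^ (N - M)) x) = (g ^^ (M + (N - M))) x" by (simp only: funpow_add comp_apply)
      also have "M + (N - M) = N" using that by simp
      finally have e: "(g ^^ M) ((g ^^ (N - M)) x) = (g ^^ N) x" .
      show ?thesis unfolding bad_def
        by (intro bexI[of _ "(g ^^ (N - M)) x"] funpow_p_torsion_part[OF that(1) x(1)]) (use x e in simp)
    qed
    define B where "B = {N. \<exists>g\<in>hom G G. bad p g N}"
    have fB: "finite B" by (rule finite_subset[of _ "{..card (?T p)}"]) (auto simp: B_def bound)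
    show ?thesis
    proof (cases "B = {}")
      case True
      then show ?thesis using pow_hom[of 1] by (auto simp: B_def)
    next
      case False
      then have "Max B \<in> B" using fB by simp
      then obtain f where f: "f \<in> hom G G" "bad p f (Max B)" by (auto simp: B_def)
      have "bad p f N" if "g \<in> hom G G" "bad p g N" for g N
        using down[OF f] Max_ge[OF fB, of N] that by (auto simp: B_def)
      then show ?thesis using f(1) by blast
    qed
  qed
  then obtain \<phi> where \<phi>: "\<And>p. prime p \<Longrightarrow> \<phi> p \<in> hom G G"
    "\<And>p N g. prime p \<Longrightarrow> g \<in> hom G G \<Longrightarrow> bad p g N \<Longrightarrow> bad p (\<phi> p) N"
    by metis
  define \<Phi> where "\<Phi> x = gfinprod G (\<lambda>p. \<phi> p (\<pi> p x)) (Collect prime)" for x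
  have \<Phi>: "\<Phi> \<in> hom G G"
    unfolding \<Phi>_def
  proof (rule hom_pointwise_finite_sum[OF comm_group_axioms])
    fix p :: nat assume "p \<in> Collect prime"
    then show "(\<lambda>x. \<phi> p (\<pi> p x)) \<in> hom G G"
      using Group.hom_compose[OF \<pi>(1) \<phi>(1), of p p] by (simp add: comp_def)
  next
    fix x assume x: "x \<in> carrier G"
    then obtain N :: nat where N: "N > 0" "x [^] N = \<one>" using tors by (auto simp: torsion_part_def)
    have "\<phi> p (\<pi> p x) = \<one>" if p: "prime p" "\<not> p dvd N" for p
    proof -
      have "\<pi> p x [^] N = \<one>"
        using hom_nat_pow[OF \<pi>(1)[OF p(1)] x is_group is_group, of N] N hom_one[OF \<pi>(1)[OF p(1)] is_group is_group]
        by simp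
      then have "\<pi> p x = \<one>" using p_torsion_eq_one[OF p(1) \<pi>(2)[OF p(1) x]] p(2) by blast
      then show ?thesis using hom_one[OF \<phi>(1)[OF p(1)] is_group is_group] by simp
    qed
    then have "{p \<in> Collect prime. \<phi> p (\<pi> p x) \<noteq> \<one>} \<subseteq> {p. p dvd N}" by blast
    then show "finite {p \<in> Collect prime. \<phi> p (\<pi> p x) \<noteq> \<one>}"
      using finite_divisors_nat[OF N(1)] finite_subset by blast
  qed (rule is_group)
  have \<Phi>_eq: "\<Phi> x = \<phi> p x" if p: "prime p" and x: "x \<in> ?T p" for p x
    unfolding \<Phi>_def
  proof (rule gfinprod_single_index[OF comm_group_axioms])
    obtain k where k: "x \<in> carrier G" "x [^] (p ^ k) = \<one>" using x by (auto simp: p_torsion_part_def)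
    show "\<phi> p x \<in> carrier G" by (rule hom_in_carrier[OF \<phi>(1)[OF p] k(1)])
    fix q assume "q \<in> Collect prime" and qp: "q \<noteq> p"
    then have q: "prime q" by simp
    have "\<pi> q x [^] (p ^ k) = \<one>"
      using hom_nat_pow[OF \<pi>(1)[OF q] k(1) is_group is_group, of "p ^ k"] k hom_one[OF \<pi>(1)[OF q] is_group is_group]
      by simp
    moreover have "\<not> q dvd p ^ k" using p q qp by (metis prime_dvd_power primes_dvd_imp_eq)
    ultimately have "\<pi> q x = \<one>" using p_torsion_eq_one[OF q \<pi>(2)[OF q k(1)]] by blast
    then show "\<phi> q (\<pi> q x) = \<one>" using hom_one[OF \<phi>(1)[OF q] is_group is_group] by simp
  qed (use p x \<pi>(3) in auto)
  have it: "(\<Phi> ^^ k) x = (\<phi> p ^^ k) x" if p: "prime p" and x: "x \<in> ?T p" for p x k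
  proof (induction k)
    case (Suc k)
    then show ?case using \<Phi>_eq[OF p funpow_p_torsion_part[OF \<phi>(1)[OF p] x]] by simp
  qed simp
  obtain n where n: "SH_exponent G \<Phi> n" using SH \<Phi> unfolding strongly_Hopfian_def by blast
  have n0: "n > 0" using n by (simp add: SH_exponent_def)
  have "SH_exponent G f n" if f: "f \<in> hom G G" for f
  proof (rule SH_exponent_if_p_torsion[OF tors f n0], rule ccontr)
    fix p x assume p: "prime p" and "x \<in> ?T p" "(f ^^ Suc n) x = \<one>" "(f ^^ n) x \<noteq> \<one>"
    then have "bad p f n" unfolding bad_def by blast
    then have "bad p (\<phi> p) n" by (rule \<phi>(2)[OF p f])
    then obtain y where y: "y \<in> ?T p" "(\<phi> p ^^ n) y \<noteq> \<one>" "(\<phi> p ^^ Suc n) y = \<one>"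
      unfolding bad_def by blast
    then have "y \<in> carrier G" by (simp add: p_torsion_part_def)
    then have "(\<Phi> ^^ n) y = \<one>"
      using SH_exponent_stable[OF \<Phi> n, of y "Suc n"] it[OF p y(1)] y(3) by metis
    then show False using y it[OF p y(1)] by simp
  qed
  then show ?thesis unfolding uniformly_strongly_Hopfian_def by blast
qed


section \<open>Groups of torsion-free rank one\<close>

text \<open>Abelian groups of torsion-free rank 1, in the form used below: there is an element of infinite
  order, and any element has a nonzero multiple in the cyclic group generated by a given element of
  infinite order.\<close>

definition rank_one :: "('a, 'b) monoid_scheme \<Rightarrow> bool"
  where "rank_one A \<longleftrightarrow> comm_group A \<and> \<not> carrier A \<subseteq> torsion_part A \<and>
    (\<forall>x\<in>carrier A. \<forall>y\<in>carrier A. y \<notin> torsion_part A \<longrightarrow>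
      (\<exists>(a::int) (b::int). a \<noteq> 0 \<and> x [^]\<^bsub>A\<^esub> a \<otimes>\<^bsub>A\<^esub> y [^]\<^bsub>A\<^esub> b = \<one>\<^bsub>A\<^esub>))"

lemma (in group) torsion_part_int:
  "x \<in> torsion_part G \<longleftrightarrow> x \<in> carrier G \<and> (\<exists>a::int. a \<noteq> 0 \<and> x [^] a = \<one>)"
proof
  assume "x \<in> torsion_part G"
  then obtain n :: nat where "x \<in> carrier G" "n > 0" "x [^] n = \<one>" by (auto simp: torsion_part_def)
  then show "x \<in> carrier G \<and> (\<exists>a::int. a \<noteq> 0 \<and> x [^] a = \<one>)"
    by (intro conjI exI[of _ "int n"]) (simp_all add: int_pow_int)
next
  assume "x \<in> carrier G \<and> (\<exists>a::int. a \<noteq> 0 \<and> x [^] a = \<one>)"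
  then obtain a :: int where a: "x \<in> carrier G" "a \<noteq> 0" "x [^] a = \<one>" by blast
  have "x [^] nat \<bar>a\<bar> = x [^] \<bar>a\<bar>" by (rule pow_nat) simp
  also have "\<dots> = \<one>" using a int_pow_neg[OF a(1), of a] by (cases "a > 0") simp_all
  finally have "x [^] nat \<bar>a\<bar> = \<one>" .
  then show "x \<in> torsion_part G" using a unfolding torsion_part_def by (auto intro!: exI[of _ "nat \<bar>a\<bar>"])
qed

lemma (in group) torsion_part_root:
  assumes "x \<in> carrier G" "(a::int) \<noteq> 0" "x [^] a \<in> torsion_part G"
  shows "x \<in> torsion_part G"
proof -
  obtain b :: int where "b \<noteq> 0" "(x [^] a) [^] b = \<one>" using assms(3) torsion_part_int by blast
  then have "a * b \<noteq> 0 \<and> x [^] (a * b) = \<one>" using assms by (simp add: int_pow_pow)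
  then show ?thesis using torsion_part_int assms(1) by blast
qed

lemma rank_one_if_class_B:
  fixes A (structure)
  assumes "class_B A"
  shows "rank_one A"
proof -
  interpret comm_group A using assms by (simp add: class_B_def)
  obtain S where S: "int_independent A S" "\<And>S'. int_independent A S' \<Longrightarrow> S \<subseteq> S' \<Longrightarrow> S' = S"
    "finite S" "card S = 1"
    using assms unfolding class_B_def has_torsion_free_rank_def by blast
  then obtain g where g: "S = {g}" by (metis card_1_singletonE)
  have gc: "g \<in> carrier A" using S(1) by (simp add: g int_independent_def)
  have fin1: "finprod A (\<lambda>x. x [^] (c x :: int)) {x} = x [^] c x" if "x \<in> carrier A" for x c
    using that by simp
  have g_free: "a = 0" if "g [^] (a::int) = \<one>" for a
  proof -
    have "\<forall>F c. finite F \<and> F \<subseteq> {g} \<and> finprod A (\<lambda>x. x [^] (c x :: int)) F = \<one> \<longrightarrow> (\<forall>x\<in>F. c x = 0)"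
      using S(1) unfolding int_independent_def g by (rule conjunct2)
    from this[rule_format, of "{g}" "\<lambda>_. a" g] show ?thesis
      using that gc by simp
  qed
  have dep: "\<exists>(a::int) (b::int). a \<noteq> 0 \<and> x [^] a \<otimes> g [^] b = \<one>" if x: "x \<in> carrier A" for x
  proof (cases "x = g")
    case True
    then show ?thesis using gc by (intro exI[of _ 1] exI[of _ "-1"]) (simp add: int_pow_neg)
  next
    case False
    then have "\<not> int_independent A {g, x}" using S(2)[of "{g, x}"] g by blast
    then obtain F c z where F: "F \<subseteq> {g, x}" "finprod A (\<lambda>x. x [^] (c x :: int)) F = \<one>" and z: "z \<in> F" "c z \<noteq> 0"
      unfolding int_independent_def using gc x by auto
    consider "F = {g}" | "F = {x}" | "F = {g, x}" using F(1) z(1) by blast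
    then show ?thesis
    proof cases
      case 1
      then show ?thesis using F(2) z g_free[of "c g"] fin1[OF gc] by simp
    next
      case 2
      then show ?thesis using F(2) z x fin1[OF x] by (intro exI[of _ "c x"] exI[of _ 0]) simp
    next
      case 3
      then have eq: "g [^] c g \<otimes> x [^] c x = \<one>" using F(2) gc x False by simp
      have "c x \<noteq> 0"
      proof
        assume "c x = 0"
        then have "c g = 0" using eq gc g_free by simp
        then show False using z 3 \<open>c x = 0\<close> by auto
      qed
      then show ?thesis using eq gc x by (intro exI[of _ "c x"] exI[of _ "c g"]) (simp add: m_comm)
    qed
  qed
  show ?thesis
    unfolding rank_one_def
  proof (intro conjI comm_group_axioms ballI impI)
    have "g \<notin> torsion_part A" using g_free torsion_part_int by blast
    then show "\<not> carrier A \<subseteq> torsion_part A" using gc by blast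
  next
    fix x y assume x: "x \<in> carrier A" and y: "y \<in> carrier A" "y \<notin> torsion_part A"
    obtain a b :: int where ab: "a \<noteq> 0" "x [^] a \<otimes> g [^] b = \<one>" using dep[OF x] by blast
    obtain c d :: int where cd: "c \<noteq> 0" "y [^] c \<otimes> g [^] d = \<one>" using dep[OF y(1)] by blast
    have "d \<noteq> 0" using cd y torsion_part_int by auto
    have xa: "x [^] a = inv (g [^] b)" using inv_equality[OF ab(2)] x gc by simp
    have yc: "y [^] c = inv (g [^] d)" using inv_equality[OF cd(2)] y gc by simp
    have "x [^] (a * d) \<otimes> y [^] (c * (- b)) = (x [^] a) [^] d \<otimes> (y [^] c) [^] (- b)"
      using x y by (simp only: int_pow_pow)
    also have "\<dots> = g [^] (- (b * d)) \<otimes> g [^] (d * b)"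
      using gc by (simp add: xa yc int_pow_pow flip: int_pow_neg)
    also have "\<dots> = \<one>" using gc by (simp add: mult.commute flip: int_pow_mult)
    finally show "\<exists>(a::int) (b::int). a \<noteq> 0 \<and> x [^] a \<otimes> y [^] b = \<one>"
      using ab(1) \<open>d \<noteq> 0\<close> by (intro exI[of _ "a * d"] exI[of _ "c * (- b)"]) simp
  qed
qed

lemma rank_one_hom_nontorsion:
  assumes A: "rank_one A" and B: "group B" and f: "f \<in> hom A B" and nt: "\<not> f ` carrier A \<subseteq> torsion_part B"
    and x: "x \<in> carrier A" "x \<notin> torsion_part A"
  shows "f x \<notin> torsion_part B"
proof
  interpret A: comm_group A using A by (simp add: rank_one_def)
  interpret B: group B by fact
  interpret f: group_hom A B f by (rule group_homI[OF A.is_group B f])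
  assume "f x \<in> torsion_part B"
  then obtain c :: int where c: "c \<noteq> 0" "f x [^]\<^bsub>B\<^esub> c = \<one>\<^bsub>B\<^esub>" using B.torsion_part_int by blast
  obtain y where y: "y \<in> carrier A" "f y \<notin> torsion_part B" using nt by blast
  obtain a b :: int where ab: "a \<noteq> 0" "y [^]\<^bsub>A\<^esub> a \<otimes>\<^bsub>A\<^esub> x [^]\<^bsub>A\<^esub> b = \<one>\<^bsub>A\<^esub>"
    using A y x unfolding rank_one_def by blast
  have "f (y [^]\<^bsub>A\<^esub> a \<otimes>\<^bsub>A\<^esub> x [^]\<^bsub>A\<^esub> b) = \<one>\<^bsub>B\<^esub>" using ab by simp
  then have e: "f y [^]\<^bsub>B\<^esub> a \<otimes>\<^bsub>B\<^esub> f x [^]\<^bsub>B\<^esub> b = \<one>\<^bsub>B\<^esub>"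
    using x y by (simp add: f.hom_int_pow)
  have "f y [^]\<^bsub>B\<^esub> a = inv\<^bsub>B\<^esub> (f x [^]\<^bsub>B\<^esub> b)"
    using B.inv_equality[OF e] x y by simp
  then have "(f y [^]\<^bsub>B\<^esub> a) [^]\<^bsub>B\<^esub> c = (f x [^]\<^bsub>B\<^esub> c) [^]\<^bsub>B\<^esub> (- b)"
    using x by (simp add: B.int_pow_pow mult.commute flip: B.int_pow_neg)
  then have "(f y [^]\<^bsub>B\<^esub> a) [^]\<^bsub>B\<^esub> c = \<one>\<^bsub>B\<^esub>" using c by simp
  then have "f y [^]\<^bsub>B\<^esub> a \<in> torsion_part B" using c(1) y(1) B.torsion_part_int by auto
  then have "f y \<in> torsion_part B" by (rule B.torsion_part_root[OF f.hom_closed[OF y(1)] ab(1)])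
  then show False using y(2) by contradiction
qed

lemma precsim_trans:
  assumes "rank_one A" "rank_one B" "group C" "A \<lesssim>\<^sub>B B" "B \<lesssim>\<^sub>B C"
  shows "A \<lesssim>\<^sub>B C"
proof -
  obtain f x where f: "f \<in> hom A B" "x \<in> carrier A" "f x \<notin> torsion_part B"
    using assms(4) unfolding precsim_def by blast
  obtain h where h: "h \<in> hom B C" "\<not> h ` carrier B \<subseteq> torsion_part C"
    using assms(5) unfolding precsim_def by blast
  have "h (f x) \<notin> torsion_part C"
    by (rule rank_one_hom_nontorsion[OF assms(2,3) h hom_in_carrier[OF f(1,2)] f(3)])
  then have "\<not> (h \<circ> f) ` carrier A \<subseteq> torsion_part C" using f(2) by auto
  then show ?thesis unfolding precsim_def using Group.hom_compose[OF f(1) h(1)] by blast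
qed

lemma precsim_refl: "rank_one A \<Longrightarrow> A \<lesssim>\<^sub>B A"
  unfolding precsim_def rank_one_def by (intro bexI[of _ id]) (auto simp: hom_def)

lemma (in group_hom) hom_finprod:
  assumes "comm_group G" "comm_group H" "f \<in> K \<rightarrow> carrier G"
  shows "h (finprod G f K) = finprod H (\<lambda>k. h (f k)) K"
proof -
  interpret G: comm_group G by fact
  interpret H: comm_group H by fact
  show ?thesis using assms(3)
    by (induction K rule: infinite_finite_induct) (auto simp: Pi_def)
qed

lemma (in comm_group) finprod_int_pow_const:
  assumes "x \<in> carrier G"
  shows "finprod G (\<lambda>k. x [^] (c k :: int)) K = x [^] sum c K"
  using assms by (induction K rule: infinite_finite_induct) (auto simp: int_pow_mult Pi_def)

lemma (in comm_group) subgroup_finprod_mem: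
  assumes "subgroup H G" "\<And>k. k \<in> K \<Longrightarrow> f k \<in> H"
  shows "finprod G f K \<in> H"
proof -
  interpret H: subgroup H G by fact
  show ?thesis using assms(2)
    by (induction K rule: infinite_finite_induct) (auto simp: Pi_def)
qed

text \<open>More vectors than coordinates are linearly dependent over the integers modulo torsion. The vectors
  \<open>w k\<close> have a coordinate in the rank-one group \<open>A i\<close> for each \<open>i \<in> E\<close>. Gaussian elimination:
  a vector \<open>w t\<close> whose coordinate at \<open>i0\<close> has infinite order serves as the pivot, and the vectors
  \<open>w'\<close> are the remaining ones after clearing that coordinate.\<close>

lemma rank_one_relation:
  fixes w :: "'k \<Rightarrow> 'i \<Rightarrow> 'a" and A :: "'i \<Rightarrow> ('a, 'b) monoid_scheme"
  assumes "finite E" "\<And>i. i \<in> E \<Longrightarrow> rank_one (A i)" "finite K" "card E < card K"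
    "\<And>k i. k \<in> K \<Longrightarrow> i \<in> E \<Longrightarrow> w k i \<in> carrier (A i)"
  shows "\<exists>q :: 'k \<Rightarrow> int. (\<exists>k\<in>K. q k \<noteq> 0) \<and>
    (\<forall>i\<in>E. finprod (A i) (\<lambda>k. w k i [^]\<^bsub>A i\<^esub> q k) K \<in> torsion_part (A i))"
  using assms
proof (induction E arbitrary: K w rule: finite_induct)
  case empty
  then obtain k where "k \<in> K" by (metis card_gt_0_iff ex_in_conv card.empty)
  then show ?case by (intro exI[of _ "\<lambda>_. 1"]) auto
next
  case (insert i0 E)
  have Ai: "comm_group (A i)" if "i \<in> insert i0 E" for i
    using insert.prems(1)[OF that] by (simp add: rank_one_def)
  interpret A0: comm_group "A i0" by (rule Ai) simp
  note tors0 = A0.subgroup_torsion_part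
  show ?case
  proof (cases "\<forall>k\<in>K. w k i0 \<in> torsion_part (A i0)")
    case True
    have "card E < card K" using insert by simp
    then obtain q :: "'k \<Rightarrow> int" where q: "\<exists>k\<in>K. q k \<noteq> 0"
      "\<forall>i\<in>E. finprod (A i) (\<lambda>k. w k i [^]\<^bsub>A i\<^esub> q k) K \<in> torsion_part (A i)"
      using insert.IH[of K w] insert.prems by auto
    have "finprod (A i0) (\<lambda>k. w k i0 [^]\<^bsub>A i0\<^esub> q k) K \<in> torsion_part (A i0)"
      using True by (intro A0.subgroup_finprod_mem[OF tors0] A0.subgroup_int_pow_mem[OF tors0]) auto
    then show ?thesis using q by (intro exI[of _ q]) auto
  next
    case False
    then obtain t where t: "t \<in> K" "w t i0 \<notin> torsion_part (A i0)" by blast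
    have "\<forall>k\<in>K. \<exists>(a::int) (b::int). a \<noteq> 0 \<and> w k i0 [^]\<^bsub>A i0\<^esub> a \<otimes>\<^bsub>A i0\<^esub> w t i0 [^]\<^bsub>A i0\<^esub> b = \<one>\<^bsub>A i0\<^esub>"
      using insert.prems(1)[of i0] insert.prems(4) t unfolding rank_one_def by simp
    then obtain \<alpha> \<beta> :: "'k \<Rightarrow> int" where \<alpha>\<beta>: "\<And>k. k \<in> K \<Longrightarrow> \<alpha> k \<noteq> 0"
      "\<And>k. k \<in> K \<Longrightarrow> w k i0 [^]\<^bsub>A i0\<^esub> \<alpha> k \<otimes>\<^bsub>A i0\<^esub> w t i0 [^]\<^bsub>A i0\<^esub> \<beta> k = \<one>\<^bsub>A i0\<^esub>"
      by metis
    define K' where "K' = K - {t}"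
    have K': "K = insert t K'" "t \<notin> K'" "finite K'" using t insert.prems by (auto simp: K'_def)
    define w' where "w' k i = w k i [^]\<^bsub>A i\<^esub> \<alpha> k \<otimes>\<^bsub>A i\<^esub> w t i [^]\<^bsub>A i\<^esub> \<beta> k" for k i
    have w'c: "w' k i \<in> carrier (A i)" if "k \<in> K'" "i \<in> insert i0 E" for k i
    proof -
      interpret Ai: comm_group "A i" by (rule Ai[OF that(2)])
      show ?thesis using insert.prems(4)[of k i] insert.prems(4)[of t i] that K' by (simp add: w'_def)
    qed
    have "card E < card K'" using insert.prems insert.hyps K' by simp
    then obtain q' :: "'k \<Rightarrow> int" where q': "\<exists>k\<in>K'. q' k \<noteq> 0"
      "\<forall>i\<in>E. finprod (A i) (\<lambda>k. w' k i [^]\<^bsub>A i\<^esub> q' k) K' \<in> torsion_part (A i)"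
      using insert.IH[of K' w'] insert.prems(1) K'(3) w'c by auto
    define q where "q k = (if k = t then \<Sum>k\<in>K'. \<beta> k * q' k else \<alpha> k * q' k)" for k
    have eq: "finprod (A i) (\<lambda>k. w k i [^]\<^bsub>A i\<^esub> q k) K = finprod (A i) (\<lambda>k. w' k i [^]\<^bsub>A i\<^esub> q' k) K'"
      if i: "i \<in> insert i0 E" for i
    proof -
      interpret Ai: comm_group "A i" by (rule Ai[OF i])
      have wc: "w k i \<in> carrier (A i)" if "k \<in> K" for k using insert.prems(4) that i by blast
      have wt: "w t i \<in> carrier (A i)" using wc t by blast
      have wk: "w k i \<in> carrier (A i)" if "k \<in> K'" for k using wc that K' by blast
      have "finprod (A i) (\<lambda>k. w' k i [^]\<^bsub>A i\<^esub> q' k) K'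
        = finprod (A i) (\<lambda>k. w k i [^]\<^bsub>A i\<^esub> (\<alpha> k * q' k) \<otimes>\<^bsub>A i\<^esub> w t i [^]\<^bsub>A i\<^esub> (\<beta> k * q' k)) K'"
        using wk wt by (intro Ai.finprod_cong) (auto simp: w'_def Ai.int_pow_distrib Ai.int_pow_pow simp_implies_def)
      also have "\<dots> = finprod (A i) (\<lambda>k. w k i [^]\<^bsub>A i\<^esub> (\<alpha> k * q' k)) K'
          \<otimes>\<^bsub>A i\<^esub> finprod (A i) (\<lambda>k. w t i [^]\<^bsub>A i\<^esub> (\<beta> k * q' k)) K'"
        using wk wt by (intro Ai.finprod_multf) auto
      also have "finprod (A i) (\<lambda>k. w t i [^]\<^bsub>A i\<^esub> (\<beta> k * q' k)) K' = w t i [^]\<^bsub>A i\<^esub> q t"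
        using Ai.finprod_int_pow_const[OF wt] by (simp add: q_def)
      also have "finprod (A i) (\<lambda>k. w k i [^]\<^bsub>A i\<^esub> (\<alpha> k * q' k)) K' = finprod (A i) (\<lambda>k. w k i [^]\<^bsub>A i\<^esub> q k) K'"
        using wk K'(2) by (intro Ai.finprod_cong) (auto simp: q_def simp_implies_def)
      also have "finprod (A i) (\<lambda>k. w k i [^]\<^bsub>A i\<^esub> q k) K' \<otimes>\<^bsub>A i\<^esub> w t i [^]\<^bsub>A i\<^esub> q t
          = finprod (A i) (\<lambda>k. w k i [^]\<^bsub>A i\<^esub> q k) K"
        unfolding K'(1) using wk wt K'(2,3) by (subst Ai.finprod_insert) (auto intro!: Ai.m_comm Ai.finprod_closed)
      finally show ?thesis by simp
    qed
    have "finprod (A i0) (\<lambda>k. w' k i0 [^]\<^bsub>A i0\<^esub> q' k) K' = \<one>\<^bsub>A i0\<^esub>"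
      using \<alpha>\<beta>(2) K' by (intro A0.finprod_one_eqI) (simp add: w'_def)
    then have "finprod (A i0) (\<lambda>k. w' k i0 [^]\<^bsub>A i0\<^esub> q' k) K' \<in> torsion_part (A i0)"
      using subgroup.one_closed[OF tors0] by simp
    then have "\<forall>i\<in>insert i0 E. finprod (A i) (\<lambda>k. w k i [^]\<^bsub>A i\<^esub> q k) K \<in> torsion_part (A i)"
      using q'(2) eq by simp
    moreover have "\<exists>k\<in>K. q k \<noteq> 0"
    proof -
      obtain k where k: "k \<in> K'" "q' k \<noteq> 0" using q'(1) by blast
      then have "k \<in> K" "q k \<noteq> 0" using \<alpha>\<beta>(1)[of k] K' by (auto simp: q_def)
      then show ?thesis by blast
    qed
    ultimately show ?thesis by blast
  qed
qed


section \<open>Direct sums of groups of torsion-free rank one\<close>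

lemma not_precsim_hom:
  "\<not> B \<lesssim>\<^sub>B C \<Longrightarrow> f \<in> hom B C \<Longrightarrow> x \<in> carrier B \<Longrightarrow> f x \<in> torsion_part C"
  unfolding precsim_def by blast

text \<open>In the rest of the argument \<open>G\<close> is the direct sum of a family of groups of torsion-free
  rank 1.\<close>

locale rank_one_family =
  fixes I :: "'i set" and A :: "'i \<Rightarrow> ('a, 'b) monoid_scheme"
  assumes rank_one_A: "i \<in> I \<Longrightarrow> rank_one (A i)"
begin

abbreviation G :: "('i \<Rightarrow> 'a) monoid" where "G \<equiv> sum_group I A"

lemma comm_A: "i \<in> I \<Longrightarrow> comm_group (A i)"
  using rank_one_A by (simp add: rank_one_def)

lemma group_A: "i \<in> I \<Longrightarrow> group (A i)"
  by (rule comm_group.axioms(2)[OF comm_A])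

lemma carrier_G: "carrier G = {x \<in> \<Pi>\<^sub>E i\<in>I. carrier (A i). finite {i \<in> I. x i \<noteq> \<one>\<^bsub>A i\<^esub>}}"
  by (rule carrier_sum_group[OF group_A])

lemma group_G: "group G"
  by (rule sum_group[OF group_A])

lemma comp_closed: "x \<in> carrier G \<Longrightarrow> i \<in> I \<Longrightarrow> x i \<in> carrier (A i)"
  by (auto simp: carrier_G)

sublocale G: comm_group G
proof (rule group.group_comm_groupI[OF group_G])
  fix x y assume xy: "x \<in> carrier G" "y \<in> carrier G"
  have "x i \<otimes>\<^bsub>A i\<^esub> y i = y i \<otimes>\<^bsub>A i\<^esub> x i" if i: "i \<in> I" for i
  proof -
    interpret Ai: comm_group "A i" by (rule comm_A[OF i])
    show ?thesis by (rule Ai.m_comm[OF comp_closed[OF xy(1) i] comp_closed[OF xy(2) i]])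
  qed
  then show "x \<otimes>\<^bsub>G\<^esub> y = y \<otimes>\<^bsub>G\<^esub> x" by (auto intro: restrict_ext)
qed

lemma proj_hom: "i \<in> I \<Longrightarrow> (\<lambda>x. x i) \<in> hom G (A i)"
  by (rule homI) (auto simp: comp_closed)

lemma comp_one: "i \<in> I \<Longrightarrow> \<one>\<^bsub>G\<^esub> i = \<one>\<^bsub>A i\<^esub>"
  by simp

text \<open>The inclusion of the \<open>i\<close>-th summand.\<close>

definition emb :: "'i \<Rightarrow> 'a \<Rightarrow> 'i \<Rightarrow> 'a"
  where "emb i a = (\<lambda>j\<in>I. if j = i then a else \<one>\<^bsub>A j\<^esub>)"

lemma emb_same: "i \<in> I \<Longrightarrow> emb i a i = a"
  by (simp add: emb_def)

lemma emb_other: "j \<in> I \<Longrightarrow> j \<noteq> i \<Longrightarrow> emb i a j = \<one>\<^bsub>A j\<^esub>"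
  by (simp add: emb_def)

lemma emb_closed:
  assumes "i \<in> I" "a \<in> carrier (A i)"
  shows "emb i a \<in> carrier G"
proof -
  have "\<one>\<^bsub>A j\<^esub> \<in> carrier (A j)" if "j \<in> I" for j
    using group.is_monoid[OF group_A[OF that]] by (rule monoid.one_closed)
  moreover have "finite {j \<in> I. emb i a j \<noteq> \<one>\<^bsub>A j\<^esub>}"
    by (rule finite_subset[of _ "{i}"]) (auto simp: emb_def)
  ultimately show ?thesis using assms by (auto simp: carrier_G emb_def)
qed

lemma emb_hom:
  assumes i: "i \<in> I"
  shows "emb i \<in> hom (A i) G"
proof (rule homI)
  fix a b assume "a \<in> carrier (A i)" "b \<in> carrier (A i)"
  have "\<one>\<^bsub>A j\<^esub> \<otimes>\<^bsub>A j\<^esub> \<one>\<^bsub>A j\<^esub> = \<one>\<^bsub>A j\<^esub>" if "j \<in> I" for j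
  proof -
    interpret Aj: comm_group "A j" by (rule comm_A[OF that])
    show ?thesis by simp
  qed
  then show "emb i (a \<otimes>\<^bsub>A i\<^esub> b) = emb i a \<otimes>\<^bsub>G\<^esub> emb i b"
    by (auto simp: emb_def fun_eq_iff)
qed (rule emb_closed[OF i])

lemma emb_one: "i \<in> I \<Longrightarrow> emb i \<one>\<^bsub>A i\<^esub> = \<one>\<^bsub>G\<^esub>"
  by (auto simp: emb_def)

lemma mem_subgroup_if_components:
  assumes H: "subgroup H G" and y: "y \<in> carrier G" and comp: "\<And>i. i \<in> I \<Longrightarrow> emb i (y i) \<in> H"
  shows "y \<in> H"
proof -
  have "y \<in> H" if "finite F" "{i \<in> I. y i \<noteq> \<one>\<^bsub>A i\<^esub>} \<subseteq> F" "y \<in> carrier G" "\<And>i. i \<in> I \<Longrightarrow> emb i (y i) \<in> H" for F y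
    using that
  proof (induction F arbitrary: y rule: finite_induct)
    case empty
    have "y = \<one>\<^bsub>G\<^esub>"
      using empty.prems(1,2) by (auto simp: carrier_G PiE_iff extensional_def fun_eq_iff)
    then show ?case using subgroup.one_closed[OF H] by (simp only:)
  next
    case (insert i F)
    show ?case
    proof (cases "i \<in> I")
      case False
      then show ?thesis using insert.IH[of y] insert.prems by blast
    next
      case True
      interpret Ai: comm_group "A i" by (rule comm_A[OF True])
      define z where "z = (\<lambda>j\<in>I. if j = i then \<one>\<^bsub>A j\<^esub> else y j)"
      have zsub: "{j \<in> I. z j \<noteq> \<one>\<^bsub>A j\<^esub>} \<subseteq> F" using insert.prems(1) by (auto simp: z_def)
      have zc: "z \<in> carrier G"
        using insert.prems(2) finite_subset[OF zsub insert.hyps(1)] True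
        by (auto simp: carrier_G z_def)
      have "emb j (z j) \<in> H" if "j \<in> I" for j
        using insert.prems(3)[OF that] emb_one[OF that] subgroup.one_closed[OF H] that by (cases "j = i") (simp_all add: z_def)
      then have zH: "z \<in> H" by (rule insert.IH[OF zsub zc])
      have "y = emb i (y i) \<otimes>\<^bsub>G\<^esub> z"
      proof
        fix j
        show "y j = (emb i (y i) \<otimes>\<^bsub>G\<^esub> z) j"
        proof (cases "j \<in> I")
          case j: True
          interpret Aj: comm_group "A j" by (rule comm_A[OF j])
          show ?thesis using comp_closed[OF insert.prems(2) j] j by (cases "j = i") (simp_all add: emb_def z_def)
        next
          case False
          then show ?thesis using insert.prems(2) by (auto simp: carrier_G PiE_iff extensional_def)
        qed
      qed
      then show ?thesis using subgroup.m_closed[OF H insert.prems(3)[OF True] zH] by simp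
    qed
  qed
  moreover have "finite {i \<in> I. y i \<noteq> \<one>\<^bsub>A i\<^esub>}" using y by (simp add: carrier_G)
  ultimately show ?thesis using y comp by blast
qed

text \<open>The elements of \<open>G\<close> all of whose components outside \<open>W\<close> are torsion.\<close>

definition torsion_off :: "'i set \<Rightarrow> ('i \<Rightarrow> 'a) set"
  where "torsion_off W = {y \<in> carrier G. \<forall>i\<in>I - W. y i \<in> torsion_part (A i)}"

lemma torsion_off_mono: "V \<subseteq> W \<Longrightarrow> torsion_off V \<subseteq> torsion_off W"
  by (auto simp: torsion_off_def)

lemma subgroup_torsion_off: "subgroup (torsion_off W) G"
proof (rule G.subgroupI)
  have tors: "subgroup (torsion_part (A i)) (A i)" if "i \<in> I" for i
    by (rule comm_group.subgroup_torsion_part[OF comm_A[OF that]])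
  have "\<one>\<^bsub>G\<^esub> \<in> torsion_off W"
    unfolding torsion_off_def using G.one_closed subgroup.one_closed[OF tors] by simp
  then show "torsion_off W \<noteq> {}" by blast
  show "inv\<^bsub>G\<^esub> a \<in> torsion_off W" if a: "a \<in> torsion_off W" for a
  proof -
    have ac: "a \<in> carrier G" using a by (simp add: torsion_off_def)
    have "inv\<^bsub>G\<^esub> a = (\<lambda>i\<in>I. inv\<^bsub>A i\<^esub> a i)" by (rule inv_sum_group[OF group_A ac])
    then show ?thesis
      using a G.inv_closed[OF ac] subgroup.m_inv_closed[OF tors] by (auto simp: torsion_off_def)
  qed
  show "a \<otimes>\<^bsub>G\<^esub> b \<in> torsion_off W" if ab: "a \<in> torsion_off W" "b \<in> torsion_off W" for a b
  proof -
    have "a \<otimes>\<^bsub>G\<^esub> b \<in> carrier G" using ab by (intro G.m_closed) (simp_all add: torsion_off_def)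
    then show ?thesis using ab subgroup.m_closed[OF tors] by (auto simp: torsion_off_def)
  qed
qed (auto simp: torsion_off_def)

lemma torsion_off_root:
  assumes y: "y \<in> carrier G" and "(a::int) \<noteq> 0" "y [^]\<^bsub>G\<^esub> a \<in> torsion_off W"
  shows "y \<in> torsion_off W"
  unfolding torsion_off_def
proof (intro CollectI conjI ballI y)
  fix i assume i: "i \<in> I - W"
  interpret Ai: comm_group "A i" by (rule comm_A) (use i in simp)
  have "(y [^]\<^bsub>G\<^esub> a) i = y i [^]\<^bsub>A i\<^esub> a"
    using hom_int_pow[OF proj_hom y group_G Ai.is_group] i by simp
  moreover have "(y [^]\<^bsub>G\<^esub> a) i \<in> torsion_part (A i)" using assms(3) i by (auto simp: torsion_off_def)
  ultimately show "y i \<in> torsion_part (A i)"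
    using Ai.torsion_part_root[of "y i" a] comp_closed[OF y] assms(2) i by simp
qed

lemma torsion_part_G: "torsion_part G = torsion_off {}"
proof
  show "torsion_part G \<subseteq> torsion_off {}"
    using hom_torsion_part[OF proj_hom group_G group_A] by (auto simp: torsion_off_def torsion_part_def[of G])
next
  show "torsion_off {} \<subseteq> torsion_part G"
  proof
    fix y assume y: "y \<in> torsion_off {}"
    show "y \<in> torsion_part G"
    proof (rule mem_subgroup_if_components[OF G.subgroup_torsion_part])
      show "y \<in> carrier G" using y by (simp add: torsion_off_def)
      fix i assume i: "i \<in> I"
      then have "y i \<in> torsion_part (A i)" using y by (simp add: torsion_off_def)
      then show "emb i (y i) \<in> torsion_part G" by (rule hom_torsion_part[OF emb_hom[OF i] group_A[OF i] group_G])
    qed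
  qed
qed

lemma precsim_A_trans: "i \<in> I \<Longrightarrow> j \<in> I \<Longrightarrow> k \<in> I \<Longrightarrow> A i \<lesssim>\<^sub>B A j \<Longrightarrow> A j \<lesssim>\<^sub>B A k \<Longrightarrow> A i \<lesssim>\<^sub>B A k"
  using precsim_trans rank_one_A group_A by blast

lemma precsim_A_refl: "i \<in> I \<Longrightarrow> A i \<lesssim>\<^sub>B A i"
  using precsim_refl rank_one_A by blast

text \<open>\<open>W\<close> is upward closed for \<open>\<lesssim>\<^sub>B\<close>. For such \<open>W\<close> the subgroup \<open>torsion_off W\<close> is invariant under all
  endomorphisms of \<open>G\<close>, by \<open>hom_torsion_off\<close> below.\<close>

definition up_closed :: "'i set \<Rightarrow> bool"
  where "up_closed W \<longleftrightarrow> (\<forall>j\<in>I \<inter> W. \<forall>i\<in>I. A j \<lesssim>\<^sub>B A i \<longrightarrow> i \<in> W)"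

lemma hom_torsion_off:
  assumes \<phi>: "\<phi> \<in> hom G G" and W: "up_closed W" and y: "y \<in> torsion_off W"
  shows "\<phi> y \<in> torsion_off W"
proof -
  have yc: "y \<in> carrier G" using y by (simp add: torsion_off_def)
  interpret \<phi>: group_hom G G \<phi> by (rule group_homI[OF group_G group_G \<phi>])
  define H where "H = {x \<in> carrier G. \<phi> x \<in> torsion_off W}"
  note TW = subgroup_torsion_off[of W]
  have H: "subgroup H G"
  proof (rule G.subgroupI)
    have "\<one>\<^bsub>G\<^esub> \<in> H" unfolding H_def using subgroup.one_closed[OF TW] \<phi>.hom_one G.one_closed by (auto simp only: mem_Collect_eq)
    then show "H \<noteq> {}" by blast
    show "inv\<^bsub>G\<^esub> a \<in> H" if "a \<in> H" for a
      using that subgroup.m_inv_closed[OF TW] by (auto simp only: H_def mem_Collect_eq \<phi>.hom_inv G.inv_closed)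
    show "a \<otimes>\<^bsub>G\<^esub> b \<in> H" if "a \<in> H" "b \<in> H" for a b
      using that subgroup.m_closed[OF TW] by (auto simp only: H_def mem_Collect_eq \<phi>.hom_mult G.m_closed)
  qed (auto simp: H_def)
  have "y \<in> H"
  proof (rule mem_subgroup_if_components[OF H yc])
    fix j assume j: "j \<in> I"
    have yj: "y j \<in> carrier (A j)" by (rule comp_closed[OF yc j])
    have ec: "emb j (y j) \<in> carrier G" by (rule emb_closed[OF j yj])
    have "\<phi> (emb j (y j)) i \<in> torsion_part (A i)" if i: "i \<in> I" "i \<notin> W" for i
    proof -
      have h: "(\<lambda>a. \<phi> (emb j a) i) \<in> hom (A j) (A i)"
        using Group.hom_compose[OF Group.hom_compose[OF emb_hom[OF j] \<phi>] proj_hom[OF i(1)]]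
        by (simp add: comp_def)
      show ?thesis
      proof (cases "j \<in> W")
        case True
        then have np: "\<not> A j \<lesssim>\<^sub>B A i" using W i j unfolding up_closed_def by blast
        show ?thesis by (rule not_precsim_hom[OF np h yj])
      next
        case False
        then have tj: "y j \<in> torsion_part (A j)" using y j by (simp add: torsion_off_def)
        show ?thesis by (rule hom_torsion_part[OF h group_A[OF j] group_A[OF i(1)] tj])
      qed
    qed
    then show "emb j (y j) \<in> H" using ec \<phi>.hom_closed[OF ec] by (simp add: H_def torsion_off_def)
  qed
  then show ?thesis by (simp add: H_def)
qed

lemma funpow_torsion_off:
  "\<phi> \<in> hom G G \<Longrightarrow> up_closed W \<Longrightarrow> y \<in> torsion_off W \<Longrightarrow> (\<phi> ^^ n) y \<in> torsion_off W"
  by (induction n) (simp_all add: hom_torsion_off)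

text \<open>The image of \<open>torsion_off W\<close> in \<open>G / torsion_off V\<close> is torsion-free of rank at most \<open>d\<close>, and \<open>\<phi>\<close>
  acts on it.
  If a power of \<open>\<phi>\<close> kills \<open>y\<close> there, then so does the \<open>d\<close>-th. Indeed the \<open>d + 1\<close> images of \<open>y\<close> under
  \<open>\<phi>\<^sup>0, \<dots>, \<phi>\<^sup>d\<close> are dependent. If the least power \<open>m'\<close> killing \<open>y\<close> exceeded \<open>d\<close>, let \<open>k0\<close> be the
  least index occurring in the relation. Applying \<open>\<phi>\<close> to the power \<open>m' - 1 - k0\<close> to the relation would leave
  a nonzero multiple of the \<open>(m' - 1)\<close>-st image alone, a contradiction.\<close>

lemma nilpotent_layer:
  assumes \<phi>: "\<phi> \<in> hom G G" and W: "up_closed W" and V: "up_closed V"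
    and E: "finite E" "E \<subseteq> I" "card E \<le> d" "W \<inter> I - V \<subseteq> E"
    and y: "y \<in> torsion_off W" and nil: "(\<phi> ^^ m) y \<in> torsion_off V"
  shows "(\<phi> ^^ d) y \<in> torsion_off V"
proof -
  define m' where "m' = (LEAST m. (\<phi> ^^ m) y \<in> torsion_off V)"
  have m': "(\<phi> ^^ m') y \<in> torsion_off V" unfolding m'_def by (rule LeastI[of _ m]) (rule nil)
  have yc: "y \<in> carrier G" using y by (simp add: torsion_off_def)
  have ge: "(\<phi> ^^ k) y \<in> torsion_off V" if "k \<ge> m'" for k
  proof -
    have "(\<phi> ^^ (k - m')) ((\<phi> ^^ m') y) \<in> torsion_off V" by (rule funpow_torsion_off[OF \<phi> V m'])
    then show ?thesis using that by (simp flip: comp_apply[of "\<phi> ^^ (k - m')"] funpow_add)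
  qed
  have "m' \<le> d"
  proof (rule ccontr)
    assume "\<not> m' \<le> d"
    have fc: "(\<phi> ^^ k) y \<in> carrier G" for k by (rule G.funpow_closed[OF \<phi> yc])
    have "\<exists>q :: nat \<Rightarrow> int. (\<exists>k\<in>{..d}. q k \<noteq> 0) \<and>
      (\<forall>i\<in>E. finprod (A i) (\<lambda>k. (\<phi> ^^ k) y i [^]\<^bsub>A i\<^esub> q k) {..d} \<in> torsion_part (A i))"
      by (rule rank_one_relation[OF E(1)]) (use E fc in \<open>auto intro: rank_one_A comp_closed\<close>)
    then obtain q :: "nat \<Rightarrow> int" where q: "\<exists>k\<in>{..d}. q k \<noteq> 0"
      "\<And>i. i \<in> E \<Longrightarrow> finprod (A i) (\<lambda>k. (\<phi> ^^ k) y i [^]\<^bsub>A i\<^esub> q k) {..d} \<in> torsion_part (A i)"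
      by blast
    define z where "z = finprod G (\<lambda>k. (\<phi> ^^ k) y [^]\<^bsub>G\<^esub> q k) {..d}"
    have zW: "z \<in> torsion_off W"
      unfolding z_def by (intro G.subgroup_finprod_mem[OF subgroup_torsion_off]
          G.subgroup_int_pow_mem[OF subgroup_torsion_off] funpow_torsion_off[OF \<phi> W y])
    have zV: "z \<in> torsion_off V"
      unfolding torsion_off_def
    proof (intro CollectI conjI ballI)
      show "z \<in> carrier G" using zW by (simp add: torsion_off_def)
      fix i assume i: "i \<in> I - V"
      show "z i \<in> torsion_part (A i)"
      proof (cases "i \<in> E")
        case False
        then show ?thesis using zW i E(4) by (auto simp: torsion_off_def)
      next
        case True
        have iI: "i \<in> I" using i by simp
        interpret Ai: comm_group "A i" by (rule comm_A[OF iI])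
        interpret p: group_hom G "A i" "\<lambda>x. x i" by (rule group_homI[OF group_G Ai.is_group proj_hom[OF iI]])
        have "z i = finprod (A i) (\<lambda>k. ((\<phi> ^^ k) y [^]\<^bsub>G\<^esub> q k) i) {..d}"
          unfolding z_def using fc by (intro p.hom_finprod G.comm_group_axioms Ai.comm_group_axioms) auto
        also have "\<dots> = finprod (A i) (\<lambda>k. (\<phi> ^^ k) y i [^]\<^bsub>A i\<^esub> q k) {..d}"
          by (simp only: p.hom_int_pow[OF fc])
        finally show ?thesis using q(2)[OF True] by simp
      qed
    qed
    define k0 where "k0 = (LEAST k. q k \<noteq> 0)"
    obtain k1 where k1: "k1 \<le> d" "q k1 \<noteq> 0" using q(1) by auto
    have k0: "q k0 \<noteq> 0" unfolding k0_def by (rule LeastI[of _ k1]) (rule k1)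
    have k0d: "k0 \<le> d" using Least_le[of "\<lambda>k. q k \<noteq> 0" k1] k1 by (simp add: k0_def)
    have low: "q k = 0" if "k < k0" for k using not_less_Least[of k "\<lambda>k. q k \<noteq> 0"] that by (simp add: k0_def)
    define r where "r = m' - 1 - k0"
    have rk: "r + k0 = m' - 1" using \<open>\<not> m' \<le> d\<close> k0d by (simp add: r_def)
    let ?t = "\<lambda>k. (\<phi> ^^ (r + k)) y [^]\<^bsub>G\<^esub> q k"
    interpret \<phi>r: group_hom G G "\<phi> ^^ r" by (rule group_homI[OF group_G group_G G.funpow_hom[OF \<phi>]])
    have "(\<phi> ^^ r) z = finprod G (\<lambda>k. (\<phi> ^^ r) ((\<phi> ^^ k) y [^]\<^bsub>G\<^esub> q k)) {..d}"
      unfolding z_def using fc by (intro \<phi>r.hom_finprod G.comm_group_axioms) auto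
    also have "\<dots> = finprod G ?t {..d}"
      by (simp only: \<phi>r.hom_int_pow[OF fc] funpow_add comp_apply)
    also have "{..d} = insert k0 ({..d} - {k0})" using k0d by auto
    also have "finprod G ?t (insert k0 ({..d} - {k0})) = ?t k0 \<otimes>\<^bsub>G\<^esub> finprod G ?t ({..d} - {k0})"
      using fc by (intro G.finprod_insert) auto
    finally have eq: "(\<phi> ^^ r) z = ?t k0 \<otimes>\<^bsub>G\<^esub> finprod G ?t ({..d} - {k0})" .
    have rest: "finprod G ?t ({..d} - {k0}) \<in> torsion_off V"
    proof (rule G.subgroup_finprod_mem[OF subgroup_torsion_off])
      fix k assume "k \<in> {..d} - {k0}"
      then consider "k < k0" | "k > k0" by fastforce
      then show "?t k \<in> torsion_off V"
      proof cases
        case 1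
        then show ?thesis using low subgroup.one_closed[OF subgroup_torsion_off] by (simp only: int_pow_0)
      next
        case 2
        then have "r + k \<ge> m'" using rk by simp
        then show ?thesis by (intro G.subgroup_int_pow_mem[OF subgroup_torsion_off] ge)
      qed
    qed
    have "?t k0 = (\<phi> ^^ r) z \<otimes>\<^bsub>G\<^esub> inv\<^bsub>G\<^esub> finprod G ?t ({..d} - {k0})"
      unfolding eq using fc subgroup.mem_carrier[OF subgroup_torsion_off rest]
      by (simp only: G.m_assoc G.r_inv G.r_one G.int_pow_closed G.inv_closed)
    also have "\<dots> \<in> torsion_off V"
      by (intro subgroup.m_closed[OF subgroup_torsion_off] subgroup.m_inv_closed[OF subgroup_torsion_off]
          rest funpow_torsion_off[OF \<phi> V zV])
    finally have "(\<phi> ^^ (r + k0)) y \<in> torsion_off V" by (rule torsion_off_root[OF fc k0])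
    then have "m' \<le> m' - 1" unfolding rk unfolding m'_def by (rule Least_le)
    then show False using \<open>\<not> m' \<le> d\<close> by simp
  qed
  then show ?thesis by (rule ge)
qed

text \<open>Chains of distinct indices, as lists. By transitivity it does not matter whether consecutive
  or arbitrary pairs are required to be related; the latter is inherited by sublists.\<close>

definition precsim_chain :: "'i list \<Rightarrow> bool"
  where "precsim_chain xs \<longleftrightarrow> distinct xs \<and> set xs \<subseteq> I \<and> sorted_wrt (\<lambda>i j. A i \<lesssim>\<^sub>B A j) xs"

lemma no_chain_iff: "no_chain I A n \<longleftrightarrow> \<not> (\<exists>xs. length xs = n \<and> precsim_chain xs)"
proof -
  have "(\<exists>i :: nat \<Rightarrow> 'i. inj_on i {1..n} \<and> i ` {1..n} \<subseteq> I \<and> (\<forall>k \<in> {1..<n}. A (i k) \<lesssim>\<^sub>B A (i (k + 1))))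
    \<longleftrightarrow> (\<exists>xs. length xs = n \<and> precsim_chain xs)" (is "?l \<longleftrightarrow> ?r")
  proof
    assume ?l
    then obtain i where i: "inj_on i {1..n}" "i ` {1..n} \<subseteq> I" "\<And>k. k \<in> {1..<n} \<Longrightarrow> A (i k) \<lesssim>\<^sub>B A (i (k + 1))"
      by blast
    have le: "A (i k) \<lesssim>\<^sub>B A (i l)" if "1 \<le> k" "k < l" "l \<le> n" for k l
      using that(2,3)
    proof (induction l)
      case (Suc l)
      show ?case
      proof (cases "k = l")
        case True
        then show ?thesis using i(3)[of l] that(1) Suc.prems by simp
      next
        case False
        then have "A (i k) \<lesssim>\<^sub>B A (i l)" using Suc by simp
        moreover have "A (i l) \<lesssim>\<^sub>B A (i (Suc l))" using i(3)[of l] that(1) Suc.prems False by simp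
        ultimately show ?thesis
          using precsim_A_trans[of "i k" "i l" "i (Suc l)"] i(2) that(1) Suc.prems by (simp add: image_subset_iff)
      qed
    qed simp
    define xs where "xs = map i [1..<Suc n]"
    have sxs: "set [1..<Suc n] = {1..n}" by auto
    have "distinct xs" unfolding xs_def distinct_map sxs using i(1) by simp
    moreover have "set xs \<subseteq> I" unfolding xs_def using i(2) sxs by (simp only: set_map)
    moreover have "sorted_wrt (\<lambda>i j. A i \<lesssim>\<^sub>B A j) xs"
      unfolding sorted_wrt_iff_nth_less by (auto simp: xs_def le nth_append simp del: upt_Suc)
    ultimately have "length xs = n \<and> precsim_chain xs" by (simp add: precsim_chain_def xs_def)
    then show ?r by blast
  next
    assume ?r
    then obtain xs where xs: "length xs = n" "precsim_chain xs" by blast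
    define i where "i k = xs ! (k - 1)" for k
    have "inj_on i {1..n}"
      using xs by (auto simp: inj_on_def i_def precsim_chain_def nth_eq_iff_index_eq)
    moreover have "i ` {1..n} \<subseteq> I"
    proof
      fix j assume "j \<in> i ` {1..n}"
      then obtain k where "k \<in> {1..n}" "j = xs ! (k - 1)" by (auto simp: i_def)
      then have "j \<in> set xs" using xs(1) by auto
      then show "j \<in> I" using xs(2) by (auto simp: precsim_chain_def)
    qed
    moreover have "A (i k) \<lesssim>\<^sub>B A (i (k + 1))" if "k \<in> {1..<n}" for k
      using xs that unfolding precsim_chain_def sorted_wrt_iff_nth_less i_def by auto
    ultimately show ?l by blast
  qed
  then show ?thesis unfolding no_chain_def by blast
qed

end


section \<open>Chains and strong Hopficity\<close>

context rank_one_family begin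

lemma precsim_chain_append_one:
  "precsim_chain (xs @ [i]) \<longleftrightarrow> precsim_chain xs \<and> i \<in> I \<and> i \<notin> set xs \<and> (\<forall>j\<in>set xs. A j \<lesssim>\<^sub>B A i)"
  unfolding precsim_chain_def by (auto simp: sorted_wrt_append)

lemma card_equiv_class_less:
  assumes no: "\<not> (\<exists>xs. length xs = n \<and> precsim_chain xs)"
    and E: "E \<subseteq> I" "\<And>i j. i \<in> E \<Longrightarrow> j \<in> E \<Longrightarrow> A i \<lesssim>\<^sub>B A j"
  shows "finite E \<and> card E < n"
proof (rule ccontr)
  assume "\<not> (finite E \<and> card E < n)"
  then obtain F where F: "F \<subseteq> E" "finite F" "card F = n"
    by (metis infinite_arbitrarily_large not_less obtain_subset_with_card_n)
  obtain xs where xs: "set xs = F" "distinct xs" using finite_distinct_list[OF F(2)] by blast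
  have "sorted_wrt (\<lambda>i j. A i \<lesssim>\<^sub>B A j) xs"
    unfolding sorted_wrt_iff_nth_less
  proof (intro allI impI)
    fix a b assume "a < b" "b < length xs"
    then have "xs ! a \<in> E" "xs ! b \<in> E" using xs(1) F(1) nth_mem[of a xs] nth_mem[of b xs] by auto
    then show "A (xs ! a) \<lesssim>\<^sub>B A (xs ! b)" by (rule E(2))
  qed
  then have "precsim_chain xs" using xs F(1) E(1) by (auto simp: precsim_chain_def)
  moreover have "length xs = n" using distinct_card[OF xs(2)] xs(1) F(3) by simp
  ultimately show False using no by blast
qed

text \<open>Induction on \<open>k\<close>, where no \<open>k\<close> indices precede \<open>i\<close> in a chain. Let \<open>D\<close> be the set of
  all indices below \<open>i\<close>, and \<open>E\<close> the class of those equivalent to \<open>i\<close>. At the indices in \<open>D - E\<close> the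
  chains are shorter by one, so there the components become torsion after \<open>n * k\<close> steps; a further
  \<open>n\<close> steps deal with the class \<open>E\<close>, by \<open>nilpotent_layer\<close> for the complements of \<open>D - E\<close> and \<open>D\<close>.\<close>

lemma component_torsion_after:
  assumes \<phi>: "\<phi> \<in> hom G G" and no: "\<not> (\<exists>xs. length xs = n \<and> precsim_chain xs)"
  shows "i \<in> I \<Longrightarrow> \<not> (\<exists>xs. length xs = k \<and> precsim_chain (xs @ [i])) \<Longrightarrow> y \<in> carrier G
    \<Longrightarrow> (\<phi> ^^ m) y \<in> torsion_part G \<Longrightarrow> (\<phi> ^^ (n * k)) y i \<in> torsion_part (A i)"
proof (induction k arbitrary: i)
  case 0
  have "precsim_chain ([] @ [i])" using 0 by (simp add: precsim_chain_def)
  then show ?case using 0 by blast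
next
  case (Suc k)
  note i = Suc.prems(1) and y = Suc.prems(3)
  define D where "D = {j \<in> I. A j \<lesssim>\<^sub>B A i}"
  define E where "E = {j \<in> D. A i \<lesssim>\<^sub>B A j}"
  define W where "W = I - (D - E)"
  define V where "V = I - D"
  have EI: "E \<subseteq> I" by (auto simp: E_def D_def)
  have iE: "i \<in> E" using i precsim_A_refl by (simp add: E_def D_def)
  have E: "finite E \<and> card E < n"
  proof (rule card_equiv_class_less[OF no EI])
    fix a b assume "a \<in> E" "b \<in> E"
    then have "a \<in> I" "b \<in> I" "A a \<lesssim>\<^sub>B A i" "A i \<lesssim>\<^sub>B A b" by (auto simp: E_def D_def)
    then show "A a \<lesssim>\<^sub>B A b" using precsim_A_trans[of a i b] i by blast
  qed
  have V: "up_closed V"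
    unfolding up_closed_def
  proof (intro ballI impI)
    fix j l assume j: "j \<in> I \<inter> V" and l: "l \<in> I" "A j \<lesssim>\<^sub>B A l"
    have "\<not> A l \<lesssim>\<^sub>B A i"
    proof
      assume "A l \<lesssim>\<^sub>B A i"
      then have "A j \<lesssim>\<^sub>B A i" using precsim_A_trans[of j l i] j l i by blast
      then show False using j by (simp add: V_def D_def)
    qed
    then show "l \<in> V" using l by (simp add: V_def D_def)
  qed
  have W: "up_closed W"
    unfolding up_closed_def
  proof (intro ballI impI)
    fix j l assume j: "j \<in> I \<inter> W" and l: "l \<in> I" "A j \<lesssim>\<^sub>B A l"
    have "l \<notin> D - E"
    proof
      assume l': "l \<in> D - E"
      then have li: "A l \<lesssim>\<^sub>B A i" by (simp add: D_def)
      then have "A j \<lesssim>\<^sub>B A i" using precsim_A_trans[of j l i] j l i by blast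
      then have "A i \<lesssim>\<^sub>B A j" using j by (simp add: W_def D_def E_def)
      then have "A i \<lesssim>\<^sub>B A l" using precsim_A_trans[of i j l] j l i by blast
      then show False using l' by (simp add: E_def)
    qed
    then show "l \<in> W" using l by (simp add: W_def)
  qed
  have yk: "(\<phi> ^^ (n * k)) y \<in> torsion_off W"
    unfolding torsion_off_def
  proof (intro CollectI conjI ballI)
    show "(\<phi> ^^ (n * k)) y \<in> carrier G" by (rule G.funpow_closed[OF \<phi> y])
    fix j assume "j \<in> I - W"
    then have jI: "j \<in> I" and ji: "A j \<lesssim>\<^sub>B A i" and ij: "\<not> A i \<lesssim>\<^sub>B A j"
      by (auto simp: W_def D_def E_def)
    have "\<not> (\<exists>xs. length xs = k \<and> precsim_chain (xs @ [j]))"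
    proof
      assume "\<exists>xs. length xs = k \<and> precsim_chain (xs @ [j])"
      then obtain xs where xs: "length xs = k" "precsim_chain (xs @ [j])" by blast
      have below: "A l \<lesssim>\<^sub>B A j" if "l \<in> set (xs @ [j])" for l
        using xs(2) that precsim_A_refl[OF jI] unfolding precsim_chain_append_one by auto
      have sub: "set (xs @ [j]) \<subseteq> I" using xs(2) by (simp add: precsim_chain_def)
      have "i \<notin> set (xs @ [j])" using below ij by blast
      moreover have "A l \<lesssim>\<^sub>B A i" if l: "l \<in> set (xs @ [j])" for l
        using precsim_A_trans[OF subsetD[OF sub l] jI i below[OF l] ji] .
      ultimately have "precsim_chain ((xs @ [j]) @ [i])"
        using xs(2) i unfolding precsim_chain_append_one[of "xs @ [j]"] by blast
      moreover have "length (xs @ [j]) = Suc k" using xs(1) by simp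
      ultimately show False using Suc.prems(2) by blast
    qed
    then show "(\<phi> ^^ (n * k)) y j \<in> torsion_part (A j)" by (rule Suc.IH[OF jI _ y Suc.prems(4)])
  qed
  have "(\<phi> ^^ (n * k)) ((\<phi> ^^ m) y) \<in> torsion_part G"
    by (rule hom_torsion_part[OF G.funpow_hom[OF \<phi>] group_G group_G Suc.prems(4)])
  then have "(\<phi> ^^ m) ((\<phi> ^^ (n * k)) y) \<in> torsion_part G"
    by (simp only: add.commute flip: comp_apply[of "\<phi> ^^ m"] comp_apply[of "\<phi> ^^ (n * k)"] funpow_add)
  then have "(\<phi> ^^ m) ((\<phi> ^^ (n * k)) y) \<in> torsion_off V"
    using torsion_part_G torsion_off_mono[of "{}" V] by blast
  moreover have "W \<inter> I - V \<subseteq> E" by (auto simp: W_def V_def)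
  moreover have "card E \<le> n" using E by simp
  ultimately have "(\<phi> ^^ n) ((\<phi> ^^ (n * k)) y) \<in> torsion_off V"
    using nilpotent_layer[OF \<phi> W V _ EI _ _ yk] E by blast
  then have "(\<phi> ^^ n) ((\<phi> ^^ (n * k)) y) i \<in> torsion_part (A i)"
    using i iE by (simp add: torsion_off_def V_def E_def)
  then show ?case by (simp add: funpow_add)
qed

lemma torsion_after:
  assumes no: "no_chain I A n" and \<phi>: "\<phi> \<in> hom G G"
    and y: "y \<in> carrier G" "(\<phi> ^^ m) y \<in> torsion_part G"
  shows "(\<phi> ^^ (n * n)) y \<in> torsion_part G"
proof -
  have no': "\<not> (\<exists>xs. length xs = n \<and> precsim_chain xs)" using no no_chain_iff by blast
  have "(\<phi> ^^ (n * n)) y i \<in> torsion_part (A i)" if "i \<in> I" for i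
  proof (rule component_torsion_after[OF \<phi> no' that _ y])
    show "\<not> (\<exists>xs. length xs = n \<and> precsim_chain (xs @ [i]))"
      using no' precsim_chain_append_one by blast
  qed
  then show ?thesis
    unfolding torsion_part_G torsion_off_def using G.funpow_closed[OF \<phi> y(1)] by blast
qed

theorem uniformly_strongly_Hopfian_if_no_chain:
  assumes no: "no_chain I A n" and T: "strongly_Hopfian (torsion_subgroup G)"
  shows "uniformly_strongly_Hopfian G"
proof -
  define T where "T = torsion_subgroup G"
  have carrier_T: "carrier T = torsion_part G" and one_T: "\<one>\<^bsub>T\<^esub> = \<one>\<^bsub>G\<^esub>"
    and mult_T: "x \<otimes>\<^bsub>T\<^esub> y = x \<otimes>\<^bsub>G\<^esub> y" for x y
    by (simp_all add: T_def torsion_subgroup_def)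
  have pow_T: "x [^]\<^bsub>T\<^esub> k = x [^]\<^bsub>G\<^esub> k" for x and k :: nat
    by (simp add: T_def torsion_subgroup_def flip: G.nat_pow_consistent)
  interpret T: comm_group T unfolding T_def by (rule G.comm_group_torsion_subgroup)
  have "carrier T \<subseteq> torsion_part T"
    by (auto simp: carrier_T torsion_part_def pow_T one_T simp del: one_sum_group)
  then have "uniformly_strongly_Hopfian T"
    using T.torsion_strongly_Hopfian_imp_uniformly T unfolding T_def by blast
  then obtain N where N: "\<And>\<psi>. \<psi> \<in> hom T T \<Longrightarrow> SH_exponent T \<psi> N"
    unfolding uniformly_strongly_Hopfian_def by blast
  have "N > 0" using N[OF T.pow_hom[of 0]] by (simp add: SH_exponent_def)
  have "SH_exponent G \<phi> (N + n * n)" if \<phi>: "\<phi> \<in> hom G G" for \<phi>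
    unfolding G.SH_exponent_iff[OF \<phi>]
  proof (intro conjI ballI impI)
    show "N + n * n > 0" using \<open>N > 0\<close> by simp
    fix y assume y: "y \<in> carrier G" and 0: "(\<phi> ^^ Suc (N + n * n)) y = \<one>\<^bsub>G\<^esub>"
    have \<phi>T: "\<phi> \<in> hom T T"
      using hom_torsion_part[OF \<phi> group_G group_G] hom_mult[OF \<phi>]
      by (intro homI) (auto simp: carrier_T mult_T torsion_part_def[of G] simp del: mult_sum_group)
    have "\<one>\<^bsub>G\<^esub> \<in> torsion_part G" by (rule subgroup.one_closed[OF G.subgroup_torsion_part])
    then have "(\<phi> ^^ Suc (N + n * n)) y \<in> torsion_part G" unfolding 0 .
    then have u: "(\<phi> ^^ (n * n)) y \<in> carrier T" unfolding carrier_T by (rule torsion_after[OF no \<phi> y])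
    have "(\<phi> ^^ Suc N) ((\<phi> ^^ (n * n)) y) = \<one>\<^bsub>T\<^esub>" using 0 by (simp only: one_T add_Suc[symmetric] funpow_add comp_apply)
    then have "(\<phi> ^^ N) ((\<phi> ^^ (n * n)) y) = \<one>\<^bsub>T\<^esub>" by (rule T.SH_exponent_stable[OF \<phi>T N[OF \<phi>T] u])
    then show "(\<phi> ^^ (N + n * n)) y = \<one>\<^bsub>G\<^esub>" by (simp only: one_T funpow_add comp_apply)
  qed
  then show ?thesis unfolding uniformly_strongly_Hopfian_def by blast
qed

lemma precsim_chain_avoiding:
  assumes "\<And>n. \<exists>xs. length xs = n \<and> precsim_chain xs" and "finite F"
  shows "\<exists>xs. length xs = n \<and> precsim_chain xs \<and> set xs \<inter> F = {}"
proof -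
  obtain xs where xs: "length xs = n + card F" "precsim_chain xs" using assms(1) by blast
  define ys where "ys = filter (\<lambda>i. i \<notin> F) xs"
  have d: "distinct xs" using xs(2) by (simp add: precsim_chain_def)
  have "card (set xs) \<le> card (set ys \<union> F)"
    by (rule card_mono) (auto simp: ys_def assms(2))
  also have "\<dots> \<le> card (set ys) + card F" by (rule card_Un_le)
  finally have "card (set xs) \<le> card (set ys) + card F" .
  moreover have "card (set xs) = length xs" "card (set ys) = length ys"
    using d by (simp_all add: distinct_card ys_def del: set_filter)
  ultimately have "n \<le> length ys" using xs(1) by simp
  moreover have "precsim_chain ys" using xs(2) by (auto simp: precsim_chain_def ys_def sorted_wrt_filter)
  then have "precsim_chain (take n ys)"
    by (auto simp: precsim_chain_def sorted_wrt_take dest: in_set_takeD)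
  moreover have "set (take n ys) \<inter> F = {}" by (auto simp: ys_def dest: in_set_takeD)
  ultimately show ?thesis by (intro exI[of _ "take n ys"]) simp
qed

text \<open>The lists \<open>c n\<close> are pairwise disjoint chains of length \<open>n + 1\<close>, the index \<open>e (n, k)\<close> is the
  \<open>k\<close>-th entry of \<open>c n\<close>, and \<open>\<Phi>\<close> sends the summand at \<open>e (n, k)\<close> to the one at \<open>e (n, k + 1)\<close>.\<close>

theorem not_strongly_Hopfian_if_chains:
  assumes chains: "\<And>n. \<exists>xs. length xs = n \<and> precsim_chain xs"
  shows "\<not> strongly_Hopfian G"
proof
  assume SH: "strongly_Hopfian G"
  define P where "P f n xs \<longleftrightarrow> length xs = Suc n \<and> precsim_chain xs \<and> set xs \<inter> (\<Union>m<n. set (f m)) = {}"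
    for f :: "nat \<Rightarrow> 'i list" and n :: nat and xs
  have "\<exists>c. \<forall>n. P c n (c n)"
  proof (rule dependent_wellorder_choice)
    fix r and f g :: "nat \<Rightarrow> 'i list" and n :: nat
    assume "\<And>m. m < n \<Longrightarrow> f m = g m"
    then have "(\<Union>m<n. set (f m)) = (\<Union>m<n. set (g m))" by simp
    then show "P f n r = P g n r" by (simp add: P_def)
  next
    fix n and f :: "nat \<Rightarrow> 'i list"
    show "\<exists>r. P f n r" unfolding P_def by (rule precsim_chain_avoiding[OF chains]) simp
  qed
  then obtain c where c: "\<And>n. P c n (c n)" by blast
  have len: "length (c n) = Suc n" and ch: "precsim_chain (c n)" for n using c[of n] by (simp_all add: P_def)
  have disj: "set (c n) \<inter> set (c m) = {}" if "n \<noteq> m" for n m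
    using c[of n] c[of m] that unfolding P_def by (cases n m rule: linorder_cases) blast+
  define e where "e = (\<lambda>(n, k). c n ! k)"
  have eI: "e (n, k) \<in> I" if "k \<le> n" for n k
    using ch[of n] len[of n] that unfolding precsim_chain_def e_def by (auto intro: nth_mem)
  have inj: "n = n' \<and> k = k'" if "e (n, k) = e (n', k')" "k \<le> n" "k' \<le> n'" for n k n' k'
  proof -
    have "c n ! k \<in> set (c n)" "c n' ! k' \<in> set (c n')" using that(2,3) by (simp_all add: len)
    then have "e (n, k) \<in> set (c n)" "e (n', k') \<in> set (c n')" by (simp_all add: e_def)
    then have "n = n'" using disj[of n n'] that(1) by auto
    moreover have "k = k'"
      using that ch[of n] len[of n] calculation by (auto simp: e_def precsim_chain_def nth_eq_iff_index_eq)
    ultimately show ?thesis by blast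
  qed
  have "A (e (n, k)) \<lesssim>\<^sub>B A (e (n, Suc k))" if "k < n" for n k
    using ch[of n] len[of n] that unfolding precsim_chain_def sorted_wrt_iff_nth_less e_def by simp
  then have "\<forall>n k. \<exists>h. k < n \<longrightarrow> h \<in> hom (A (e (n, k))) (A (e (n, Suc k))) \<and>
      \<not> h ` carrier (A (e (n, k))) \<subseteq> torsion_part (A (e (n, Suc k)))"
    unfolding precsim_def by blast
  then obtain h where h: "\<And>n k. k < n \<Longrightarrow> h n k \<in> hom (A (e (n, k))) (A (e (n, Suc k)))"
    "\<And>n k. k < n \<Longrightarrow> \<not> h n k ` carrier (A (e (n, k))) \<subseteq> torsion_part (A (e (n, Suc k)))"
    by metis
  define L where "L = {(n, k). k < (n :: nat)}"
  define f where "f = (\<lambda>(n, k) x. emb (e (n, Suc k)) (h n k (x (e (n, k)))))"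
  define \<Phi> where "\<Phi> x = gfinprod G (\<lambda>l. f l x) L" for x
  have f_one: "f (n, k) x = \<one>\<^bsub>G\<^esub>" if "k < n" "x (e (n, k)) = \<one>\<^bsub>A (e (n, k))\<^esub>" for n k x
    using that hom_one[OF h(1)[OF that(1)] group_A[OF eI] group_A[OF eI]] emb_one[OF eI[of "Suc k" n]]
    by (simp add: f_def del: one_sum_group)
  have \<Phi>: "\<Phi> \<in> hom G G"
    unfolding \<Phi>_def
  proof (rule hom_pointwise_finite_sum[OF G.comm_group_axioms])
    fix l assume "l \<in> L"
    then obtain n k where l: "l = (n, k)" "k < n" by (auto simp: L_def)
    have "(emb (e (n, Suc k)) \<circ> (h n k \<circ> (\<lambda>x. x (e (n, k))))) \<in> hom G G"
      using l(2) by (intro Group.hom_compose[OF Group.hom_compose[OF proj_hom h(1)] emb_hom] eI) simp_all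
    then show "f l \<in> hom G G" by (simp add: f_def l comp_def)
  next
    fix x assume x: "x \<in> carrier G"
    have "e ` {l \<in> L. f l x \<noteq> \<one>\<^bsub>G\<^esub>} \<subseteq> {i \<in> I. x i \<noteq> \<one>\<^bsub>A i\<^esub>}"
      using f_one eI by (auto simp: L_def simp del: one_sum_group)
    moreover have "finite {i \<in> I. x i \<noteq> \<one>\<^bsub>A i\<^esub>}" using x by (simp add: carrier_G)
    ultimately have "finite (e ` {l \<in> L. f l x \<noteq> \<one>\<^bsub>G\<^esub>})" by (rule finite_subset)
    moreover have "inj_on e {l \<in> L. f l x \<noteq> \<one>\<^bsub>G\<^esub>}"
      by (rule inj_onI) (use inj in \<open>auto simp: L_def less_imp_le\<close>)
    ultimately show "finite {l \<in> L. f l x \<noteq> \<one>\<^bsub>G\<^esub>}" by (rule finite_imageD)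
  qed (rule group_G)
  have other: "f (n', k') (emb (e (n, k)) a) = \<one>\<^bsub>G\<^esub>" if "k \<le> n" "k' < n'" "(n', k') \<noteq> (n, k)" for n k n' k' a
  proof (rule f_one[OF that(2)])
    have "e (n', k') \<noteq> e (n, k)" using inj[of n' k' n k] that by auto
    then show "emb (e (n, k)) a (e (n', k')) = \<one>\<^bsub>A (e (n', k'))\<^esub>"
      using that(2) by (intro emb_other eI) auto
  qed
  have step: "\<Phi> (emb (e (n, k)) a) = emb (e (n, Suc k)) (h n k a)" if k: "k < n" and a: "a \<in> carrier (A (e (n, k)))" for n k a
    unfolding \<Phi>_def
  proof (rule gfinprod_single_index[OF G.comm_group_axioms, of "(n, k)"])
    show "(n, k) \<in> L" using k by (simp add: L_def)
    show "emb (e (n, Suc k)) (h n k a) \<in> carrier G"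
      using k a by (intro emb_closed eI hom_in_carrier[OF h(1)]) simp_all
    show "f l (emb (e (n, k)) a) = \<one>\<^bsub>G\<^esub>" if "l \<in> L" "l \<noteq> (n, k)" for l
      using that other[of k n _ _ a] k by (cases l) (simp add: L_def del: one_sum_group)
    show "f (n, k) (emb (e (n, k)) a) = emb (e (n, Suc k)) (h n k a)"
      using k emb_same[OF eI] by (simp add: f_def)
  qed
  have last: "\<Phi> (emb (e (n, n)) a) = \<one>\<^bsub>G\<^esub>" for n a
  proof -
    have "f l (emb (e (n, n)) a) = \<one>\<^bsub>G\<^esub>" if "l \<in> L" for l
      using that other[of n n _ _ a] by (cases l) (auto simp: L_def simp del: one_sum_group)
    then have "{l \<in> L. f l (emb (e (n, n)) a) \<noteq> \<one>\<^bsub>G\<^esub>} = {}" by blast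
    then show ?thesis unfolding \<Phi>_def gfinprod_def by (simp only: finite.emptyI if_True G.finprod_empty)
  qed
  obtain n where n: "SH_exponent G \<Phi> n" using SH \<Phi> unfolding strongly_Hopfian_def by blast
  obtain a where a: "a \<in> carrier (A (e (n, 0)))" "a \<notin> torsion_part (A (e (n, 0)))"
    using rank_one_A[OF eI[of 0 n]] unfolding rank_one_def by blast
  let ?x = "emb (e (n, 0)) a"
  have it: "\<exists>b. b \<in> carrier (A (e (n, k))) \<and> b \<notin> torsion_part (A (e (n, k))) \<and> (\<Phi> ^^ k) ?x = emb (e (n, k)) b"
    if "k \<le> n" for k
    using that
  proof (induction k)
    case 0
    then show ?case using a by auto
  next
    case (Suc k)
    then obtain b where b: "b \<in> carrier (A (e (n, k)))" "b \<notin> torsion_part (A (e (n, k)))"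
      "(\<Phi> ^^ k) ?x = emb (e (n, k)) b" by auto
    have k: "k < n" using Suc.prems by simp
    have "h n k b \<notin> torsion_part (A (e (n, Suc k)))"
      using k by (intro rank_one_hom_nontorsion[OF rank_one_A group_A h(1) h(2) b(1,2)] eI) simp_all
    moreover have "h n k b \<in> carrier (A (e (n, Suc k)))" by (rule hom_in_carrier[OF h(1)[OF k] b(1)])
    moreover have "(\<Phi> ^^ Suc k) ?x = emb (e (n, Suc k)) (h n k b)" using step[OF k b(1)] b(3) by simp
    ultimately show ?case by blast
  qed
  obtain b where b: "b \<notin> torsion_part (A (e (n, n)))" "(\<Phi> ^^ n) ?x = emb (e (n, n)) b" using it[of n] by blast
  have "(\<Phi> ^^ Suc n) ?x = \<one>\<^bsub>G\<^esub>" using last b(2) by simp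
  then have "(\<Phi> ^^ n) ?x = \<one>\<^bsub>G\<^esub>"
    by (rule G.SH_exponent_stable[OF \<Phi> n emb_closed[OF eI[of 0 n] a(1)], rotated]) simp
  then have "emb (e (n, n)) b (e (n, n)) = \<one>\<^bsub>G\<^esub> (e (n, n))" using b(2) by simp
  then have "b = \<one>\<^bsub>A (e (n, n))\<^esub>" using emb_same[OF eI] comp_one[OF eI] by simp
  then show False
    using b(1) subgroup.one_closed[OF comm_group.subgroup_torsion_part[OF comm_A[OF eI[of n n]]]] by simp
qed

end


theorem theorem3p3:
  fixes I :: "'i set" and A :: "'i \<Rightarrow> ('a, 'b) monoid_scheme" and G :: "('i \<Rightarrow> 'a) monoid"
  assumes "G = sum_group I A"
    and "\<And>i. i \<in> I \<Longrightarrow> class_B (A i)"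
    and "Warfield_group TYPE('x) G"
  shows "(strongly_Hopfian G \<longrightarrow> (\<exists>n>0. no_chain I A n)) \<and>
    (uniformly_strongly_Hopfian G \<longleftrightarrow>
       (\<exists>n>0. no_chain I A n) \<and> strongly_Hopfian (torsion_subgroup G))"
proof -
  interpret R: rank_one_family I A
    using assms(2) by unfold_locales (rule rank_one_if_class_B)
  have part1: "\<exists>n>0. no_chain I A n" if "strongly_Hopfian (sum_group I A)"
  proof (rule ccontr)
    assume none: "\<not> (\<exists>n>0. no_chain I A n)"
    have "\<exists>xs. length xs = n \<and> R.precsim_chain xs" for n
    proof (cases n)
      case 0
      then show ?thesis by (simp add: R.precsim_chain_def)
    next
      case (Suc m)
      then show ?thesis using none R.no_chain_iff by blast
    qed
    then show False using R.not_strongly_Hopfian_if_chains that by blast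
  qed
  have "uniformly_strongly_Hopfian (sum_group I A) \<longleftrightarrow>
      (\<exists>n>0. no_chain I A n) \<and> strongly_Hopfian (torsion_subgroup (sum_group I A))"
    using part1 R.uniformly_strongly_Hopfian_if_no_chain
      R.G.uniformly_strongly_Hopfian_torsion_subgroup uniformly_strongly_Hopfian_imp_strongly_Hopfian by blast
  then show ?thesis using part1 unfolding assms(1) by blast
qed

end
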